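(* Let $F$ be the universal formal group law over the Lazard ring $L$, let $\omega(x)=\frac{\partial F(x,y)}{\partial y}(x,0)$ be its invariant form, and define elements $A_{ij}\in L$ by $$\sum A_{ij}x^iy^j=F(x,y)\bigl(x\omega(y)-y\omega(x)\bigr).$$ Let $\mathcal{F}_b$, $\mathcal{F}_{Kr}$ and $\mathcal{F}_N$ be the universal Buchstaber, Krichever and Nadiradze formal group laws, respectively (defined in the context). Then these coincide, $$\mathcal{F}_b=\mathcal{F}_{Kr}=\mathcal{F}_N,$$ and their coefficient ring is the quotient of the Lazard ring $L$ by the ideal generated by all $A_{ij}$ with $i,j\ge 3$.
   Context: All formal group laws are one-dimensional and commutative, over commutative rings with unit. The Lazard ring $L$ carries the universal formal group law $F$: every formal group law $G$ over a ring $R$ is obtained by applying a unique ring homomorphism $r:L\to R$ (the classifying map of $G$) to the coefficients of $F$. The universal Nadiradze formal group law $\mathcal{F}_N$ is the formal group law over $L/(A_{ij}: i,j\ge 3)$ classified by the quotient map. The universal Krichever formal group law $\mathcal{F}_{Kr}$ is the universal formal group law among those, over arbitrary commutative rings $R$, of the form $$xb(y)+yb(x)-b'(0)xy+\frac{b(x)\beta(x)-b(y)\beta(y)}{xb(y)-yb(x)}x^2y^2,\qquad \beta(x)=\frac{b'(x)-b'(0)}{2x},$$ with $b(x)\in R[[x]]$, $b(0)=1$; here $\beta(x)\in R[[x]]$ is a power series with $2x\beta(x)=b'(x)-b'(0)$. The universal Buchstaber formal group law $\mathcal{F}_b$ is the universal formal group law among those, over arbitrary commutative rings $R$, of the form $$u_1c(u_2)+u_2c(u_1)-au_1u_2-\frac{d(u_1)-d(u_2)}{u_1c(u_2)-u_2c(u_1)}u_1^2u_2^2,$$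 with $c(u),d(u)\in R[[u]]$, $c(0)=1$, $a\in R$, normalized by $c'(0)=a$. In these formulas the quotients are the evident power series: since $b(0)=c(0)=1$, the denominators are $(x-y)$ (respectively $u_1-u_2$) times an invertible power series, and the numerators are divisible by $x-y$ (respectively $u_1-u_2$). "Universal among formal group laws of a given form" means: a formal group law of that form over a ring $R_0$ (its coefficient ring) such that every formal group law of that form over any commutative ring $R$ is obtained from it by applying a unique ring homomorphism $R_0\to R$ to the coefficients. Coincidence of the three means that they are classified by the same quotient of $L$; equivalently, a formal group law over a ring $R$ is of one of these forms (for the Nadiradze case: its classifying map kills all $A_{ij}$, $i,j\ge 3$) if and only if it is of each of the other forms. *)

theory Defs
  imports "HOL-Algebra.QuotRing"
begin

section \<open>Formal power series over a ring given by a carrier\<close>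

text \<open>
  \<open>FPS R\<close> is $R[[x]]$; a series is its sequence of coefficients.  Iterating, \<open>FPS (FPS R)\<close> is
  $R[[x,y]]$ and \<open>FPS (FPS (FPS R))\<close> is $R[[x,y,z]]$: their elements are functions
  \<open>f :: nat \<Rightarrow> nat \<Rightarrow> 'a\<close> with \<open>f i j\<close> the coefficient of $x^i y^j$, respectively functions
  \<open>f :: nat \<Rightarrow> nat \<Rightarrow> nat \<Rightarrow> 'a\<close> with \<open>f i j k\<close> the coefficient of $x^i y^j z^k$.
\<close>

definition FPS :: "('a, 'm) ring_scheme \<Rightarrow> (nat \<Rightarrow> 'a) ring" where
  "FPS R =
    \<lparr>carrier = {f. \<forall>n. f n \<in> carrier R},
     mult = (\<lambda>f g n. \<Oplus>\<^bsub>R\<^esub>k\<in>{..n}. f k \<otimes>\<^bsub>R\<^esub> g (n - k)),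
     one = (\<lambda>n. if n = 0 then \<one>\<^bsub>R\<^esub> else \<zero>\<^bsub>R\<^esub>),
     zero = (\<lambda>n. \<zero>\<^bsub>R\<^esub>),
     add = (\<lambda>f g n. f n \<oplus>\<^bsub>R\<^esub> g n)\<rparr>"

abbreviation FPS2 :: "('a, 'm) ring_scheme \<Rightarrow> (nat \<Rightarrow> nat \<Rightarrow> 'a) ring" where
  "FPS2 R \<equiv> FPS (FPS R)"

abbreviation FPS3 :: "('a, 'm) ring_scheme \<Rightarrow> (nat \<Rightarrow> nat \<Rightarrow> nat \<Rightarrow> 'a) ring" where
  "FPS3 R \<equiv> FPS (FPS (FPS R))"

definition ps_const :: "('a, 'm) ring_scheme \<Rightarrow> 'a \<Rightarrow> nat \<Rightarrow> 'a" where
  "ps_const R c = (\<lambda>n. if n = 0 then c else \<zero>\<^bsub>R\<^esub>)"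

definition ps_X :: "('a, 'm) ring_scheme \<Rightarrow> nat \<Rightarrow> 'a" where
  "ps_X R = (\<lambda>n. if n = 1 then \<one>\<^bsub>R\<^esub> else \<zero>\<^bsub>R\<^esub>)"

definition ps_deriv :: "('a, 'm) ring_scheme \<Rightarrow> (nat \<Rightarrow> 'a) \<Rightarrow> nat \<Rightarrow> 'a" where
  "ps_deriv R f = (\<lambda>n. [Suc n] \<cdot>\<^bsub>R\<^esub> f (Suc n))"

text \<open>The series $f(x)$ and $f(y)$ in $R[[x,y]]$.\<close>

definition in_x :: "('a, 'm) ring_scheme \<Rightarrow> (nat \<Rightarrow> 'a) \<Rightarrow> nat \<Rightarrow> nat \<Rightarrow> 'a" where
  "in_x R f = (\<lambda>i j. if j = 0 then f i else \<zero>\<^bsub>R\<^esub>)"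

definition in_y :: "('a, 'm) ring_scheme \<Rightarrow> (nat \<Rightarrow> 'a) \<Rightarrow> nat \<Rightarrow> nat \<Rightarrow> 'a" where
  "in_y R f = (\<lambda>i j. if i = 0 then f j else \<zero>\<^bsub>R\<^esub>)"

abbreviation var_x :: "('a, 'm) ring_scheme \<Rightarrow> nat \<Rightarrow> nat \<Rightarrow> 'a" where
  "var_x R \<equiv> in_x R (ps_X R)"

abbreviation var_y :: "('a, 'm) ring_scheme \<Rightarrow> nat \<Rightarrow> nat \<Rightarrow> 'a" where
  "var_y R \<equiv> in_y R (ps_X R)"

abbreviation const2 :: "('a, 'm) ring_scheme \<Rightarrow> 'a \<Rightarrow> nat \<Rightarrow> nat \<Rightarrow> 'a" where
  "const2 R c \<equiv> in_x R (ps_const R c)"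

text \<open>
  \<open>subst3 R F g h\<close> is $F(g,h) = \sum_{m,n} F_{mn}\, g^m h^n$ in $R[[x,y,z]]$, for $g, h$ with zero
  constant term.  Then $g^m h^n$ has no terms of degree below $m+n$, so only $m, n \le i+j+k$
  contribute to the coefficient of $x^i y^j z^k$, and the sum below is the full one.
\<close>

definition subst3 :: "('a, 'm) ring_scheme \<Rightarrow> (nat \<Rightarrow> nat \<Rightarrow> 'a) \<Rightarrow>
    (nat \<Rightarrow> nat \<Rightarrow> nat \<Rightarrow> 'a) \<Rightarrow> (nat \<Rightarrow> nat \<Rightarrow> nat \<Rightarrow> 'a) \<Rightarrow> nat \<Rightarrow> nat \<Rightarrow> nat \<Rightarrow> 'a" where
  "subst3 R F g h = (\<lambda>i j k.
     \<Oplus>\<^bsub>R\<^esub>m\<in>{..i+j+k}. \<Oplus>\<^bsub>R\<^esub>n\<in>{..i+j+k}.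
       F m n \<otimes>\<^bsub>R\<^esub> ((g [^]\<^bsub>FPS3 R\<^esub> m) \<otimes>\<^bsub>FPS3 R\<^esub> (h [^]\<^bsub>FPS3 R\<^esub> n)) i j k)"

definition in_xy :: "('a, 'm) ring_scheme \<Rightarrow> (nat \<Rightarrow> nat \<Rightarrow> 'a) \<Rightarrow> nat \<Rightarrow> nat \<Rightarrow> nat \<Rightarrow> 'a" where
  "in_xy R f = (\<lambda>i j k. if k = 0 then f i j else \<zero>\<^bsub>R\<^esub>)"

definition in_yz :: "('a, 'm) ring_scheme \<Rightarrow> (nat \<Rightarrow> nat \<Rightarrow> 'a) \<Rightarrow> nat \<Rightarrow> nat \<Rightarrow> nat \<Rightarrow> 'a" where
  "in_yz R f = (\<lambda>i j k. if i = 0 then f j k else \<zero>\<^bsub>R\<^esub>)"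


section \<open>Formal group laws\<close>

definition formal_group_law :: "('a, 'm) ring_scheme \<Rightarrow> (nat \<Rightarrow> nat \<Rightarrow> 'a) \<Rightarrow> bool" where
  "formal_group_law R F \<longleftrightarrow>
     cring R \<and> F \<in> carrier (FPS2 R) \<and>
     (\<lambda>i. F i 0) = ps_X R \<and> (\<lambda>j. F 0 j) = ps_X R \<and>
     (\<forall>i j. F i j = F j i) \<and>
     subst3 R F (in_xy R F) (in_yz R (var_y R)) = subst3 R F (in_xy R (var_x R)) (in_yz R F)"

definition classifying_map ::
    "('a, 'm) ring_scheme \<Rightarrow> (nat \<Rightarrow> nat \<Rightarrow> 'a) \<Rightarrow> ('b, 'n) ring_scheme \<Rightarrow> (nat \<Rightarrow> nat \<Rightarrow> 'b) \<Rightarrow>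
     ('a \<Rightarrow> 'b) \<Rightarrow> bool" where
  "classifying_map R\<^sub>0 F R G r \<longleftrightarrow> r \<in> ring_hom R\<^sub>0 R \<and> (\<forall>i j. r (F i j) = G i j)"

text \<open>
  \<open>classifies P R\<^sub>0 F\<close>: every pair $(R, G)$ with property \<open>P\<close> is obtained from $F$ by a unique ring
  homomorphism $R_0 \to R$ (the condition on \<open>extensional\<close> fixes the irrelevant values outside the
  carrier).  HOL cannot quantify over types inside a formula, so \<open>R\<close> ranges over all rings whose
  carrier lies in the type \<open>'r\<close>; the universal properties below take this type as an argument.
\<close>

definition classifies :: "('r ring \<Rightarrow> (nat \<Rightarrow> nat \<Rightarrow> 'r) \<Rightarrow> bool) \<Rightarrow>
    ('a, 'm) ring_scheme \<Rightarrow> (nat \<Rightarrow> nat \<Rightarrow> 'a) \<Rightarrow> bool" where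
  "classifies P R\<^sub>0 F \<longleftrightarrow>
     (\<forall>R G. P R G \<longrightarrow> (\<exists>!r. r \<in> extensional (carrier R\<^sub>0) \<and> classifying_map R\<^sub>0 F R G r))"

definition universal_formal_group_law ::
    "'r itself \<Rightarrow> ('a, 'm) ring_scheme \<Rightarrow> (nat \<Rightarrow> nat \<Rightarrow> 'a) \<Rightarrow> bool" where
  "universal_formal_group_law T L F \<longleftrightarrow>
     formal_group_law L F \<and>
     classifies (formal_group_law :: 'r ring \<Rightarrow> (nat \<Rightarrow> nat \<Rightarrow> 'r) \<Rightarrow> bool) L F"


section \<open>The Nadiradze formal group law\<close>

definition invariant_form :: "('a, 'm) ring_scheme \<Rightarrow> (nat \<Rightarrow> nat \<Rightarrow> 'a) \<Rightarrow> nat \<Rightarrow> 'a" where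
  "invariant_form R F = (\<lambda>i. ps_deriv R (F i) 0)"

definition A_coeffs :: "('a, 'm) ring_scheme \<Rightarrow> (nat \<Rightarrow> nat \<Rightarrow> 'a) \<Rightarrow> nat \<Rightarrow> nat \<Rightarrow> 'a" where
  "A_coeffs R F =
     F \<otimes>\<^bsub>FPS2 R\<^esub> (var_x R \<otimes>\<^bsub>FPS2 R\<^esub> in_y R (invariant_form R F)
                 \<ominus>\<^bsub>FPS2 R\<^esub> var_y R \<otimes>\<^bsub>FPS2 R\<^esub> in_x R (invariant_form R F))"

definition nadiradze_ideal :: "('a, 'm) ring_scheme \<Rightarrow> (nat \<Rightarrow> nat \<Rightarrow> 'a) \<Rightarrow> 'a set" where
  "nadiradze_ideal L F = Idl\<^bsub>L\<^esub> {A_coeffs L F i j | i j. i \<ge> 3 \<and> j \<ge> 3}"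

definition nadiradze_ring :: "('a, 'm) ring_scheme \<Rightarrow> (nat \<Rightarrow> nat \<Rightarrow> 'a) \<Rightarrow> 'a set ring" where
  "nadiradze_ring L F = L Quot nadiradze_ideal L F"

text \<open>The formal group law over \<open>nadiradze_ring L F\<close> classified by the quotient map.\<close>

definition universal_nadiradze_law ::
    "('a, 'm) ring_scheme \<Rightarrow> (nat \<Rightarrow> nat \<Rightarrow> 'a) \<Rightarrow> nat \<Rightarrow> nat \<Rightarrow> 'a set" where
  "universal_nadiradze_law L F = (\<lambda>i j. nadiradze_ideal L F +>\<^bsub>L\<^esub> F i j)"

definition nadiradze_law ::
    "('a, 'm) ring_scheme \<Rightarrow> (nat \<Rightarrow> nat \<Rightarrow> 'a) \<Rightarrow> ('b, 'n) ring_scheme \<Rightarrow> (nat \<Rightarrow> nat \<Rightarrow> 'b) \<Rightarrow> bool"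
    where
  "nadiradze_law L F R G \<longleftrightarrow>
     formal_group_law R G \<and>
     (\<exists>r. classifying_map L F R G r \<and> (\<forall>i\<ge>3. \<forall>j\<ge>3. r (A_coeffs L F i j) = \<zero>\<^bsub>R\<^esub>))"


section \<open>The Krichever and Buchstaber formal group laws\<close>

text \<open>
  In both forms the quotient is the series \<open>q\<close> with quotient times denominator equal to the
  numerator; it exists and is unique, since the denominator is $x - y$ times a unit of $R[[x,y]]$
  and the numerator is divisible by $x - y$.
\<close>

definition krichever_law :: "('a, 'm) ring_scheme \<Rightarrow> (nat \<Rightarrow> nat \<Rightarrow> 'a) \<Rightarrow> bool" where
  "krichever_law R G \<longleftrightarrow>
     formal_group_law R G \<and>
     (\<exists>b\<in>carrier (FPS R). \<exists>\<beta>\<in>carrier (FPS R). \<exists>q\<in>carrier (FPS2 R).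
        let x = var_x R; y = var_y R; b\<^sub>1 = ps_deriv R b 0 in
        b 0 = \<one>\<^bsub>R\<^esub> \<and>
        [(2::nat)] \<cdot>\<^bsub>FPS R\<^esub> (ps_X R \<otimes>\<^bsub>FPS R\<^esub> \<beta>) = ps_deriv R b \<ominus>\<^bsub>FPS R\<^esub> ps_const R b\<^sub>1 \<and>
        q \<otimes>\<^bsub>FPS2 R\<^esub> (x \<otimes>\<^bsub>FPS2 R\<^esub> in_y R b \<ominus>\<^bsub>FPS2 R\<^esub> y \<otimes>\<^bsub>FPS2 R\<^esub> in_x R b) =
          in_x R b \<otimes>\<^bsub>FPS2 R\<^esub> in_x R \<beta> \<ominus>\<^bsub>FPS2 R\<^esub> in_y R b \<otimes>\<^bsub>FPS2 R\<^esub> in_y R \<beta> \<and>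
        G = (x \<otimes>\<^bsub>FPS2 R\<^esub> in_y R b \<oplus>\<^bsub>FPS2 R\<^esub> y \<otimes>\<^bsub>FPS2 R\<^esub> in_x R b
              \<ominus>\<^bsub>FPS2 R\<^esub> const2 R b\<^sub>1 \<otimes>\<^bsub>FPS2 R\<^esub> x \<otimes>\<^bsub>FPS2 R\<^esub> y)
            \<oplus>\<^bsub>FPS2 R\<^esub> q \<otimes>\<^bsub>FPS2 R\<^esub> x [^]\<^bsub>FPS2 R\<^esub> (2::nat) \<otimes>\<^bsub>FPS2 R\<^esub> y [^]\<^bsub>FPS2 R\<^esub> (2::nat))"

definition buchstaber_law :: "('a, 'm) ring_scheme \<Rightarrow> (nat \<Rightarrow> nat \<Rightarrow> 'a) \<Rightarrow> bool" where
  "buchstaber_law R G \<longleftrightarrow>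
     formal_group_law R G \<and>
     (\<exists>c\<in>carrier (FPS R). \<exists>d\<in>carrier (FPS R). \<exists>a\<in>carrier R. \<exists>q\<in>carrier (FPS2 R).
        let u\<^sub>1 = var_x R; u\<^sub>2 = var_y R in
        c 0 = \<one>\<^bsub>R\<^esub> \<and>
        ps_deriv R c 0 = a \<and>
        q \<otimes>\<^bsub>FPS2 R\<^esub> (u\<^sub>1 \<otimes>\<^bsub>FPS2 R\<^esub> in_y R c \<ominus>\<^bsub>FPS2 R\<^esub> u\<^sub>2 \<otimes>\<^bsub>FPS2 R\<^esub> in_x R c) =
          in_x R d \<ominus>\<^bsub>FPS2 R\<^esub> in_y R d \<and>
        G = (u\<^sub>1 \<otimes>\<^bsub>FPS2 R\<^esub> in_y R c \<oplus>\<^bsub>FPS2 R\<^esub> u\<^sub>2 \<otimes>\<^bsub>FPS2 R\<^esub> in_x R c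
              \<ominus>\<^bsub>FPS2 R\<^esub> const2 R a \<otimes>\<^bsub>FPS2 R\<^esub> u\<^sub>1 \<otimes>\<^bsub>FPS2 R\<^esub> u\<^sub>2)
            \<ominus>\<^bsub>FPS2 R\<^esub> q \<otimes>\<^bsub>FPS2 R\<^esub> u\<^sub>1 [^]\<^bsub>FPS2 R\<^esub> (2::nat) \<otimes>\<^bsub>FPS2 R\<^esub> u\<^sub>2 [^]\<^bsub>FPS2 R\<^esub> (2::nat))"

definition universal_krichever_law ::
    "'r itself \<Rightarrow> ('a, 'm) ring_scheme \<Rightarrow> (nat \<Rightarrow> nat \<Rightarrow> 'a) \<Rightarrow> bool" where
  "universal_krichever_law T R\<^sub>0 F \<longleftrightarrow>
     krichever_law R\<^sub>0 F \<and>
     classifies (krichever_law :: 'r ring \<Rightarrow> (nat \<Rightarrow> nat \<Rightarrow> 'r) \<Rightarrow> bool) R\<^sub>0 F"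

definition universal_buchstaber_law ::
    "'r itself \<Rightarrow> ('a, 'm) ring_scheme \<Rightarrow> (nat \<Rightarrow> nat \<Rightarrow> 'a) \<Rightarrow> bool" where
  "universal_buchstaber_law T R\<^sub>0 F \<longleftrightarrow>
     buchstaber_law R\<^sub>0 F \<and>
     classifies (buchstaber_law :: 'r ring \<Rightarrow> (nat \<Rightarrow> nat \<Rightarrow> 'r) \<Rightarrow> bool) R\<^sub>0 F"

end

theory Submission
  imports Defs
begin

text \<open>
  Write \<open>\<omega>\<close> for the invariant form.  Every formal group law can be written as
  $F = x\omega(y) + y\omega(x) - \omega'(0)xy + q(x,y)x^2y^2$, and then, up to monomials $x^iy^j$ with
  $\min(i,j)\le 2$,
  $F\cdot(x\omega(y) - y\omega(x)) \equiv q(x,y)(x\omega(y) - y\omega(x))x^2y^2$.  Hence all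
  $A_{ij}$ with $i,j\ge 3$ vanish iff $q(x,y)(x\omega(y) - y\omega(x))$ has no mixed terms, that is,
  is of the form $g(x) - g(y)$: this is the Buchstaber form with $c = \omega$.  One may take for
  $x g(x)$ the coefficient of $y^2$ in $F$, and associativity gives
  $2x g(x) = \omega(x)(\omega'(x) - \omega'(0))$ over any ring, so $\beta = g/\omega$ exhibits the
  Krichever form even when there is 2-torsion.
\<close>

section \<open>Power series rings\<close>

text \<open>That the coefficient of $y^2$ supplies \<open>g\<close> is seen by setting $y=0$: since
  $\<omega>(0)=1$, the denominator becomes $x$, so $g(x)$ has to be $x q(x,0)$ up to a constant. The
  constant cancels in $g(x)-g(y)$; the relation between \<open>\<beta>\<close> and $b'$ is what
  selects it. Division by 2 is impossible in general, so this relation has to come out of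
  associativity, and first order in $y$ and $z$ suffices. There $F(F(x,y),z)$ yields
  $\<omega>\<omega>'$, while $F(x,F(y,z))$ yields the coefficient of $y^2$ twice, because $(y+z)^2$
  contains $2yz$, plus $\<omega>'(0)\<omega>$ from the term $yz$ of $F(y,z)$ itself. The $A_{ij}$ of
  a law are integer polynomials in its coefficients, so their vanishing is a condition on the law
  alone that passes along ring homomorphisms. Comparing the three notions thus becomes a cycle of
  implications over one fixed ring, and both universal properties follow from that of $L$ and that
  of a quotient ring.\<close>

lemma FPS_sel:
  "f \<in> carrier (FPS R) \<longleftrightarrow> (\<forall>n. f n \<in> carrier R)"
  "(f \<otimes>\<^bsub>FPS R\<^esub> g) n = (\<Oplus>\<^bsub>R\<^esub>k\<in>{..n}. f k \<otimes>\<^bsub>R\<^esub> g (n - k))"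
  "(f \<oplus>\<^bsub>FPS R\<^esub> g) n = f n \<oplus>\<^bsub>R\<^esub> g n"
  "\<one>\<^bsub>FPS R\<^esub> n = (if n = 0 then \<one>\<^bsub>R\<^esub> else \<zero>\<^bsub>R\<^esub>)"
  "\<zero>\<^bsub>FPS R\<^esub> n = \<zero>\<^bsub>R\<^esub>"
  by (auto simp: FPS_def)

section \<open>Power series in one variable\<close>

context cring
begin

text \<open>Associativity of convolution is the case $k = n$. Bounding the outer sum by a separate
  $k$ allows induction: a step from $k$ to $k+1$ leaves the factors \<open>h (n - i)\<close> alone
  and adds one term to each inner sum on the right.\<close>

lemma conv_assoc:
  assumes f: "\<And>k::nat. f k \<in> carrier R" and g: "\<And>k::nat. g k \<in> carrier R"
    and h: "\<And>k::nat. h k \<in> carrier R" and "k \<le> n"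
  shows "(\<Oplus>i\<in>{..k}. (\<Oplus>j\<in>{..i}. f j \<otimes> g (i - j)) \<otimes> h (n - i)) =
         (\<Oplus>j\<in>{..k}. f j \<otimes> (\<Oplus>i\<in>{..k - j}. g i \<otimes> h (n - j - i)))"
  using assms(4)
proof (induction k)
  case 0
  then show ?case by (simp add: f g h m_assoc)
next
  case (Suc k)
  \<comment> \<open>\<open>U k j\<close> is the inner sum on the right-hand side, and
    \<open>V j\<close> is the term it gains when $k$ grows by one.\<close>
  define U where "U k j = (\<Oplus>i\<in>{..k - j}. g i \<otimes> h (n - j - i))" for k j
  define V where "V j = g (Suc k - j) \<otimes> h (n - Suc k)" for j
  have U: "U k j \<in> carrier R" and V: "V j \<in> carrier R" for k j
    using g h by (auto simp: U_def V_def)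
  have split: "U (Suc k) j = V j \<oplus> U k j" if "j \<le> k" for j
  proof -
    have d: "Suc k - j = Suc (k - j)" "n - Suc k = n - j - Suc (k - j)" using that by auto
    show ?thesis unfolding U_def V_def d
      by (rule finsum_Suc) (use g h in auto)
  qed
  have last: "U (Suc k) (Suc k) = g 0 \<otimes> h (n - Suc k)" using g h by (simp add: U_def)
  have "(\<Oplus>j\<in>{..Suc k}. f j \<otimes> g (Suc k - j)) \<otimes> h (n - Suc k) =
      (f (Suc k) \<otimes> g 0 \<oplus> (\<Oplus>j\<in>{..k}. f j \<otimes> g (Suc k - j))) \<otimes> h (n - Suc k)"
    using f g by (simp add: finsum_Suc)
  also have "\<dots> = f (Suc k) \<otimes> U (Suc k) (Suc k) \<oplus>
      (\<Oplus>j\<in>{..k}. f j \<otimes> g (Suc k - j) \<otimes> h (n - Suc k))"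
    using f g h by (simp add: l_distr finsum_ldistr last m_assoc)
  also have "(\<Oplus>j\<in>{..k}. f j \<otimes> g (Suc k - j) \<otimes> h (n - Suc k)) = (\<Oplus>j\<in>{..k}. f j \<otimes> V j)"
    using f g h by (simp add: V_def m_assoc)
  finally have T: "(\<Oplus>j\<in>{..Suc k}. f j \<otimes> g (Suc k - j)) \<otimes> h (n - Suc k) =
      f (Suc k) \<otimes> U (Suc k) (Suc k) \<oplus> (\<Oplus>j\<in>{..k}. f j \<otimes> V j)" .
  have "(\<Oplus>j\<in>{..k}. f j \<otimes> U (Suc k) j) = (\<Oplus>j\<in>{..k}. f j \<otimes> V j \<oplus> f j \<otimes> U k j)"
    by (rule finsum_cong) (use f U V in \<open>auto simp: split r_distr simp_implies_def\<close>)
  also have "\<dots> = (\<Oplus>j\<in>{..k}. f j \<otimes> V j) \<oplus> (\<Oplus>j\<in>{..k}. f j \<otimes> U k j)"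
    by (rule finsum_addf) (use f U V in auto)
  finally have S: "(\<Oplus>j\<in>{..k}. f j \<otimes> U (Suc k) j) = \<dots>" .
  have "(\<Oplus>i\<in>{..Suc k}. (\<Oplus>j\<in>{..i}. f j \<otimes> g (i - j)) \<otimes> h (n - i)) =
     (\<Oplus>j\<in>{..Suc k}. f j \<otimes> g (Suc k - j)) \<otimes> h (n - Suc k) \<oplus> (\<Oplus>j\<in>{..k}. f j \<otimes> U k j)"
    unfolding U_def Suc.IH[OF Suc_leD[OF Suc.prems], symmetric]
    by (rule finsum_Suc) (use f g h in auto)
  also have "\<dots> = (\<Oplus>j\<in>{..Suc k}. f j \<otimes> U (Suc k) j)"
    unfolding T finsum_Suc[of "\<lambda>j. f j \<otimes> U (Suc k) j" k, OF Pi_I, OF m_closed[OF f U]] S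
    using f U V by (simp add: a_assoc)
  finally show ?case unfolding U_def .
qed

lemma conv_comm:
  assumes "\<And>k::nat. f k \<in> carrier R" "\<And>k::nat. g k \<in> carrier R"
  shows "(\<Oplus>k\<in>{..n}. f k \<otimes> g (n - k)) = (\<Oplus>k\<in>{..n}. g k \<otimes> f (n - k))"
proof -
  have img: "(\<lambda>k. n - k) ` {..n} = {..n}"
    by (auto simp: image_iff) (metis atMost_iff diff_diff_cancel diff_le_self)
  have "(\<Oplus>k\<in>(\<lambda>k. n - k) ` {..n}. f k \<otimes> g (n - k)) = (\<Oplus>k\<in>{..n}. f (n - k) \<otimes> g (n - (n - k)))"
    by (rule finsum_reindex) (auto simp: assms inj_on_def)
  also have "\<dots> = (\<Oplus>k\<in>{..n}. g k \<otimes> f (n - k))"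
    by (rule finsum_cong) (auto simp: assms m_comm simp_implies_def)
  finally show ?thesis by (simp add: img)
qed

text \<open>Since \<open>R\<close> is an arbitrary commutative ring, it may itself be a power series
  ring; the rings in two and three variables and their coefficient rules are obtained by
  iteration.\<close>

lemma cring_FPS: "cring (FPS R)"
proof (rule cringI)
  show "abelian_group (FPS R)"
  proof (rule abelian_groupI)
    fix f assume "f \<in> carrier (FPS R)"
    then show "\<exists>g\<in>carrier (FPS R). g \<oplus>\<^bsub>FPS R\<^esub> f = \<zero>\<^bsub>FPS R\<^esub>"
      by (intro bexI[of _ "\<lambda>n. \<ominus> f n"]) (auto simp: FPS_sel fun_eq_iff l_neg)
  qed (auto simp: FPS_sel fun_eq_iff a_ac)
  show "Group.comm_monoid (FPS R)"
  proof (rule comm_monoidI)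
    fix f g h assume "f \<in> carrier (FPS R)" "g \<in> carrier (FPS R)" "h \<in> carrier (FPS R)"
    then show "f \<otimes>\<^bsub>FPS R\<^esub> g \<otimes>\<^bsub>FPS R\<^esub> h = f \<otimes>\<^bsub>FPS R\<^esub> (g \<otimes>\<^bsub>FPS R\<^esub> h)"
      using conv_assoc[of f g h n n for n] by (simp add: FPS_sel fun_eq_iff)
  next
    fix f g assume "f \<in> carrier (FPS R)" "g \<in> carrier (FPS R)"
    then show "f \<otimes>\<^bsub>FPS R\<^esub> g = g \<otimes>\<^bsub>FPS R\<^esub> f"
      using conv_comm[of f g] by (simp add: FPS_sel fun_eq_iff)
  next
    fix f assume f: "f \<in> carrier (FPS R)"
    show "\<one>\<^bsub>FPS R\<^esub> \<otimes>\<^bsub>FPS R\<^esub> f = f"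
    proof
      fix n
      have "(\<one>\<^bsub>FPS R\<^esub> \<otimes>\<^bsub>FPS R\<^esub> f) n = (\<Oplus>k\<in>{..n}. if 0 = k then f (n - k) else \<zero>)"
        unfolding FPS_sel using f by (intro finsum_cong) (auto simp: FPS_sel simp_implies_def)
      also have "\<dots> = f n"
        using finsum_singleton[of 0 "{..n}" "\<lambda>k. f (n - k)"] f by (simp add: FPS_sel)
      finally show "(\<one>\<^bsub>FPS R\<^esub> \<otimes>\<^bsub>FPS R\<^esub> f) n = f n" .
    qed
  qed (auto simp: FPS_sel)
  fix f g h assume "f \<in> carrier (FPS R)" "g \<in> carrier (FPS R)" "h \<in> carrier (FPS R)"
  then show "(f \<oplus>\<^bsub>FPS R\<^esub> g) \<otimes>\<^bsub>FPS R\<^esub> h = f \<otimes>\<^bsub>FPS R\<^esub> h \<oplus>\<^bsub>FPS R\<^esub> g \<otimes>\<^bsub>FPS R\<^esub> h"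
    by (simp add: FPS_sel fun_eq_iff l_distr finsum_addf)
qed

text \<open>The ring record has no field for negation, so the coefficients of the negative are found
  through uniqueness of additive inverses in \<open>R\<close>.\<close>

lemma FPS_uminus:
  assumes "f \<in> carrier (FPS R)"
  shows "(\<ominus>\<^bsub>FPS R\<^esub> f) n = \<ominus> f n"
proof -
  interpret P: cring "FPS R" by (rule cring_FPS)
  have "(\<ominus>\<^bsub>FPS R\<^esub> f \<oplus>\<^bsub>FPS R\<^esub> f) n = \<zero>"
    using assms by (simp add: P.l_neg FPS_sel)
  moreover have "\<ominus>\<^bsub>FPS R\<^esub> f \<in> carrier (FPS R)" using assms by simp
  ultimately show ?thesis
    using assms minus_equality by (simp add: FPS_sel)
qed

lemma FPS_minus:
  assumes "f \<in> carrier (FPS R)" "g \<in> carrier (FPS R)"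
  shows "(f \<ominus>\<^bsub>FPS R\<^esub> g) n = f n \<ominus> g n"
  using assms by (simp add: a_minus_def FPS_sel FPS_uminus)

lemma FPS_finsum:
  assumes "\<And>k. k \<in> A \<Longrightarrow> f k \<in> carrier (FPS R)" "finite A"
  shows "(\<Oplus>\<^bsub>FPS R\<^esub>k\<in>A. f k) n = (\<Oplus>k\<in>A. f k n)"
proof -
  interpret P: cring "FPS R" by (rule cring_FPS)
  show ?thesis
    using assms(2,1)
  proof (induction A)
    case empty
    show ?case by (simp add: FPS_sel)
  next
    case (insert a A)
    then have "f \<in> A \<rightarrow> carrier (FPS R)" "f a \<in> carrier (FPS R)" by auto
    moreover from this have "(\<lambda>k. f k n) \<in> A \<rightarrow> carrier R" "f a n \<in> carrier R"
      by (auto simp: FPS_sel Pi_iff)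
    ultimately show ?case using insert by (simp add: FPS_sel)
  qed
qed

lemma FPS_add_pow:
  assumes "f \<in> carrier (FPS R)"
  shows "([(k::nat)] \<cdot>\<^bsub>FPS R\<^esub> f) n = [k] \<cdot> f n"
proof -
  interpret P: cring "FPS R" by (rule cring_FPS)
  show ?thesis
    using assms by (induction k) (simp_all add: FPS_sel)
qed

lemma ps_const_closed [simp]: "c \<in> carrier R \<Longrightarrow> ps_const R c \<in> carrier (FPS R)"
  by (simp add: FPS_sel ps_const_def)

lemma ps_X_closed [simp]: "ps_X R \<in> carrier (FPS R)"
  by (simp add: FPS_sel ps_X_def)

lemma FPS_mult_const:
  assumes "f \<in> carrier (FPS R)" "c \<in> carrier R"
  shows "(f \<otimes>\<^bsub>FPS R\<^esub> ps_const R c) n = f n \<otimes> c" "(ps_const R c \<otimes>\<^bsub>FPS R\<^esub> f) n = c \<otimes> f n"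
proof -
  interpret P: cring "FPS R" by (rule cring_FPS)
  have "(ps_const R c \<otimes>\<^bsub>FPS R\<^esub> f) n = (\<Oplus>k\<in>{..n}. if 0 = k then c \<otimes> f (n - k) else \<zero>)"
    unfolding FPS_sel using assms
    by (intro finsum_cong) (auto simp: FPS_sel ps_const_def simp_implies_def)
  also have "\<dots> = c \<otimes> f n"
    using finsum_singleton[of 0 "{..n}" "\<lambda>k. c \<otimes> f (n - k)"] assms by (simp add: FPS_sel)
  finally show "(ps_const R c \<otimes>\<^bsub>FPS R\<^esub> f) n = c \<otimes> f n" .
  then show "(f \<otimes>\<^bsub>FPS R\<^esub> ps_const R c) n = f n \<otimes> c"
    using assms by (simp add: P.m_comm m_comm) (simp add: FPS_sel m_comm)
qed

lemma FPS_mult_X: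
  assumes "f \<in> carrier (FPS R)"
  shows "(f \<otimes>\<^bsub>FPS R\<^esub> ps_X R) n = (if n = 0 then \<zero> else f (n - 1))"
    "(ps_X R \<otimes>\<^bsub>FPS R\<^esub> f) n = (if n = 0 then \<zero> else f (n - 1))"
proof -
  interpret P: cring "FPS R" by (rule cring_FPS)
  show "(ps_X R \<otimes>\<^bsub>FPS R\<^esub> f) n = (if n = 0 then \<zero> else f (n - 1))"
  proof (cases n)
    case 0
    then show ?thesis using assms by (simp add: FPS_sel ps_X_def)
  next
    case (Suc m)
    have "(ps_X R \<otimes>\<^bsub>FPS R\<^esub> f) n = (\<Oplus>k\<in>{..n}. if 1 = k then f (n - k) else \<zero>)"
      unfolding FPS_sel using assms
      by (intro finsum_cong) (auto simp: FPS_sel ps_X_def simp_implies_def)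
    also have "\<dots> = f m"
      using finsum_singleton[of 1 "{..n}" "\<lambda>k. f (n - k)"] assms Suc by (simp add: FPS_sel)
    finally show ?thesis using Suc by simp
  qed
  then show "(f \<otimes>\<^bsub>FPS R\<^esub> ps_X R) n = (if n = 0 then \<zero> else f (n - 1))"
    using assms by (simp add: P.m_comm)
qed

lemma FPS_X_pow: "(ps_X R [^]\<^bsub>FPS R\<^esub> (n::nat)) k = (if k = n then \<one> else \<zero>)"
proof -
  interpret P: cring "FPS R" by (rule cring_FPS)
  show ?thesis
  proof (induction n arbitrary: k)
    case 0
    show ?case by (simp add: FPS_sel)
  next
    case (Suc n)
    then show ?case by (auto simp: FPS_mult_X)
  qed
qed

lemma ps_deriv_closed [simp]: "f \<in> carrier (FPS R) \<Longrightarrow> ps_deriv R f \<in> carrier (FPS R)"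
  by (simp add: ps_deriv_def FPS_sel)

text \<open>Because $b_0 = 1$, comparing coefficients in $fb = g$ gives a recursion for $f_n$ that
  never divides by anything. It provides both $\<beta> = g/b$ and the inverse of $b$.\<close>

lemma FPS_divide_exists:
  assumes b: "b \<in> carrier (FPS R)" "b 0 = \<one>" and g: "g \<in> carrier (FPS R)"
  shows "\<exists>f\<in>carrier (FPS R). b \<otimes>\<^bsub>FPS R\<^esub> f = g"
proof -
  interpret P: cring "FPS R" by (rule cring_FPS)
  \<comment> \<open>Course-of-values recursion: \<open>cut f less_than n\<close> agrees with
    \<open>f\<close> below \<open>n\<close>, and the sum looks only there.\<close>
  define f where "f = wfrec less_than (\<lambda>rec n. g n \<ominus> (\<Oplus>k\<in>{..<n}. rec k \<otimes> b (n - k)))"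
  have rec: "f n = g n \<ominus> (\<Oplus>k\<in>{..<n}. cut f less_than n k \<otimes> b (n - k))" for n
    using def_wfrec[OF f_def[THEN eq_reflection] wf_less_than, of n] by (simp only:)
  have closed: "f n \<in> carrier R" for n
  proof (induction n rule: less_induct)
    case (less n)
    then have "(\<lambda>k. cut f less_than n k \<otimes> b (n - k)) \<in> {..<n} \<rightarrow> carrier R"
      using b by (auto simp: cut_def FPS_sel)
    then show ?case using g by (subst rec) (simp add: FPS_sel)
  qed
  have "(f \<otimes>\<^bsub>FPS R\<^esub> b) n = g n" for n
  proof -
    define S where "S = (\<Oplus>k\<in>{..<n}. f k \<otimes> b (n - k))"
    have S: "S \<in> carrier R" using closed b by (simp add: S_def FPS_sel)
    have "(f \<otimes>\<^bsub>FPS R\<^esub> b) n = (\<Oplus>k\<in>insert n {..<n}. f k \<otimes> b (n - k))"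
      by (simp add: FPS_sel ivl_disj_un flip: lessThan_Suc_atMost lessThan_Suc)
    also have "\<dots> = f n \<oplus> S"
      unfolding S_def using closed b by (subst finsum_insert) (auto simp: FPS_sel)
    also have "f n = g n \<ominus> S"
      unfolding rec[of n] S_def using closed b
      by (auto simp: cut_def FPS_sel simp_implies_def intro!: arg_cong2[of _ _ _ _ "a_minus R"] finsum_cong)
    also have "g n \<ominus> S \<oplus> S = g n" using g S by (simp add: FPS_sel a_minus_def a_assoc l_neg)
    finally show ?thesis .
  qed
  then have "f \<otimes>\<^bsub>FPS R\<^esub> b = g" by (rule ext)
  moreover have f: "f \<in> carrier (FPS R)" using closed by (simp add: FPS_sel)
  ultimately show ?thesis using P.m_comm[OF b(1) f] by auto
qed

end

section \<open>Coefficientwise homomorphisms and embeddings into more variables\<close>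

lemma ring_hom_FPS:
  assumes "cring R" "cring S" "h \<in> ring_hom R S"
  shows "(\<lambda>f n. h (f n)) \<in> ring_hom (FPS R) (FPS S)"
proof -
  interpret ring_hom_cring R S h
    using assms by (simp add: ring_hom_cring_def ring_hom_cring_axioms_def)
  show ?thesis
    by (rule ring_hom_memI) (auto simp: FPS_sel fun_eq_iff o_def)
qed

lemma ring_hom_a_inv:
  assumes "ring R" "ring S" "h \<in> ring_hom R S" "a \<in> carrier R"
  shows "h (\<ominus>\<^bsub>R\<^esub> a) = \<ominus>\<^bsub>S\<^esub> h a"
proof -
  interpret ring_hom_ring R S h
    using assms by (simp add: ring_hom_ringI2)
  show ?thesis using assms(4) by simp
qed

lemma ring_hom_minus:
  assumes "ring R" "ring S" "h \<in> ring_hom R S" "a \<in> carrier R" "b \<in> carrier R"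
  shows "h (a \<ominus>\<^bsub>R\<^esub> b) = h a \<ominus>\<^bsub>S\<^esub> h b"
proof -
  interpret ring_hom_ring R S h
    using assms by (simp add: ring_hom_ringI2)
  show ?thesis using assms(4,5) by (simp add: a_minus_def)
qed

lemma ring_hom_nat_pow:
  assumes "ring R" "ring S" "h \<in> ring_hom R S" "a \<in> carrier R"
  shows "h (a [^]\<^bsub>R\<^esub> (n::nat)) = h a [^]\<^bsub>S\<^esub> n"
  using ring_hom_ring.hom_nat_pow[OF ring_hom_ringI2[OF assms(1-3)] assms(4)] .

text \<open>In \<open>f i j\<close> the exponent of $x$ is the outer index. A series in $x$ is
  therefore embedded coefficient by coefficient, whereas a series in $y$ is a constant of the outer
  ring. Expressed by \<open>ps_const\<close>, the embeddings are visibly ring homomorphisms.\<close>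

lemma in_x_eq: "in_x R = (\<lambda>f i. ps_const R (f i))"
  by (simp add: in_x_def ps_const_def fun_eq_iff)

lemma in_y_eq: "in_y R = ps_const (FPS R)"
  by (auto simp: in_y_def ps_const_def fun_eq_iff FPS_sel)

lemma in_xy_eq: "in_xy R = (\<lambda>f i j. ps_const R (f i j))"
  by (simp add: in_xy_def ps_const_def fun_eq_iff)

lemma in_yz_eq: "in_yz R = ps_const (FPS2 R)"
  by (auto simp: in_yz_def ps_const_def fun_eq_iff FPS_sel)

lemma var_x_eq: "var_x R = ps_X (FPS R)"
  by (auto simp: in_x_def ps_X_def fun_eq_iff FPS_sel)

text \<open>Lets a constant pass through the homomorphism \<open>in_y\<close> as well as through
  \<open>in_x\<close>.\<close>

lemma const2_eq: "const2 R c = in_y R (ps_const R c)"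
  by (auto simp: in_x_def in_y_def ps_const_def fun_eq_iff)

context cring
begin

lemma cring_FPS2: "cring (FPS2 R)"
  by (rule cring.cring_FPS[OF cring_FPS])

lemma cring_FPS3: "cring (FPS3 R)"
  by (rule cring.cring_FPS[OF cring_FPS2])

lemma ps_const_hom: "ps_const R \<in> ring_hom R (FPS R)"
proof -
  interpret P: cring "FPS R" by (rule cring_FPS)
  show ?thesis
    by (rule ring_hom_memI) (simp_all add: fun_eq_iff FPS_mult_const, auto simp: FPS_sel ps_const_def)
qed

lemma in_x_hom: "in_x R \<in> ring_hom (FPS R) (FPS2 R)"
  unfolding in_x_eq by (intro ring_hom_FPS cring_FPS is_cring ps_const_hom)

lemma in_y_hom: "in_y R \<in> ring_hom (FPS R) (FPS2 R)"
  unfolding in_y_eq by (intro cring.ps_const_hom cring_FPS)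

lemma in_xy_hom: "in_xy R \<in> ring_hom (FPS2 R) (FPS3 R)"
  unfolding in_xy_eq by (intro ring_hom_FPS cring_FPS cring_FPS2 is_cring ps_const_hom)

lemma in_yz_hom: "in_yz R \<in> ring_hom (FPS2 R) (FPS3 R)"
  unfolding in_yz_eq by (rule cring.ps_const_hom[OF cring_FPS2])

lemma in_closed [simp]:
  "f \<in> carrier (FPS R) \<Longrightarrow> in_x R f \<in> carrier (FPS2 R)"
  "f \<in> carrier (FPS R) \<Longrightarrow> in_y R f \<in> carrier (FPS2 R)"
  by (rule ring_hom_closed[OF in_x_hom], assumption) (rule ring_hom_closed[OF in_y_hom])

lemma FPS2_mult_x:
  assumes "f \<in> carrier (FPS2 R)"
  shows "(f \<otimes>\<^bsub>FPS2 R\<^esub> var_x R) i j = (if i = 0 then \<zero> else f (i - 1) j)"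
  unfolding var_x_eq cring.FPS_mult_X(1)[OF cring_FPS assms] by (simp add: FPS_sel(5))

lemma FPS2_mult_in_y:
  assumes "f \<in> carrier (FPS2 R)" "b \<in> carrier (FPS R)"
  shows "(f \<otimes>\<^bsub>FPS2 R\<^esub> in_y R b) i = f i \<otimes>\<^bsub>FPS R\<^esub> b"
  using assms by (simp add: in_y_eq cring.FPS_mult_const[OF cring_FPS])

lemma FPS2_mult_y:
  assumes "f \<in> carrier (FPS2 R)"
  shows "(f \<otimes>\<^bsub>FPS2 R\<^esub> var_y R) i j = (if j = 0 then \<zero> else f i (j - 1))"
proof -
  have "f i \<in> carrier (FPS R)" using assms by (simp add: FPS_sel(1)[of f])
  then show ?thesis using assms by (simp add: FPS2_mult_in_y FPS_mult_X)
qed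

lemma FPS2_mult_in_x:
  assumes "f \<in> carrier (FPS2 R)" "b \<in> carrier (FPS R)"
  shows "(f \<otimes>\<^bsub>FPS2 R\<^esub> in_x R b) i j = (\<Oplus>k\<in>{..i}. f k j \<otimes> b (i - k))"
proof -
  interpret P: cring "FPS R" by (rule cring_FPS)
  have *: "f k \<in> carrier (FPS R)" "b k \<in> carrier R" "f k j \<in> carrier R" for k
    using assms by (auto simp: FPS_sel)
  have "(f \<otimes>\<^bsub>FPS2 R\<^esub> in_x R b) i j = (\<Oplus>k\<in>{..i}. (f k \<otimes>\<^bsub>FPS R\<^esub> ps_const R (b (i - k))) j)"
    unfolding FPS_sel(2)[where R="FPS R"] in_x_eq using * by (subst FPS_finsum) auto
  also have "\<dots> = (\<Oplus>k\<in>{..i}. f k j \<otimes> b (i - k))"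
    by (rule finsum_cong) (use * in \<open>auto simp: FPS_mult_const simp_implies_def\<close>)
  finally show ?thesis .
qed

lemma FPS2_add: "(f \<oplus>\<^bsub>FPS2 R\<^esub> g) i j = f i j \<oplus> g i j"
  by (simp add: FPS_sel)

lemma FPS2_minus:
  assumes "f \<in> carrier (FPS2 R)" "g \<in> carrier (FPS2 R)"
  shows "(f \<ominus>\<^bsub>FPS2 R\<^esub> g) i j = f i j \<ominus> g i j"
proof -
  have "f i \<in> carrier (FPS R)" "g i \<in> carrier (FPS R)" using assms by (auto simp: FPS_sel(1)[where R="FPS R"])
  then show ?thesis using assms by (simp add: cring.FPS_minus[OF cring_FPS] FPS_minus)
qed

text \<open>Multiplication modulo $y^2$ with coefficients in $R[[x]]$: the series are regrouped by
  powers of $y$, the inner index. The second rule is the Leibniz rule behind the powers of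
  $G$.\<close>

lemma FPS2_mult_coeffs01:
  assumes "f \<in> carrier (FPS2 R)" "g \<in> carrier (FPS2 R)"
  shows "(\<lambda>i. (f \<otimes>\<^bsub>FPS2 R\<^esub> g) i 0) = (\<lambda>i. f i 0) \<otimes>\<^bsub>FPS R\<^esub> (\<lambda>i. g i 0)"
    and "(\<lambda>i. (f \<otimes>\<^bsub>FPS2 R\<^esub> g) i (Suc 0)) =
      (\<lambda>i. f i 0) \<otimes>\<^bsub>FPS R\<^esub> (\<lambda>i. g i (Suc 0)) \<oplus>\<^bsub>FPS R\<^esub> (\<lambda>i. f i (Suc 0)) \<otimes>\<^bsub>FPS R\<^esub> (\<lambda>i. g i 0)"
proof -
  interpret P: cring "FPS R" by (rule cring_FPS)
  have *: "f k \<in> carrier (FPS R)" "g k \<in> carrier (FPS R)" "f k j \<in> carrier R" "g k j \<in> carrier R" for k j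
    using assms by (auto simp: FPS_sel)
  have eq: "(f \<otimes>\<^bsub>FPS2 R\<^esub> g) i j = (\<Oplus>k\<in>{..i}. (f k \<otimes>\<^bsub>FPS R\<^esub> g (i - k)) j)" for i j
    unfolding FPS_sel(2)[where R="FPS R"] using * by (subst FPS_finsum) auto
  show "(\<lambda>i. (f \<otimes>\<^bsub>FPS2 R\<^esub> g) i 0) = (\<lambda>i. f i 0) \<otimes>\<^bsub>FPS R\<^esub> (\<lambda>i. g i 0)"
    unfolding eq using * by (simp add: fun_eq_iff FPS_sel(2))
  show "(\<lambda>i. (f \<otimes>\<^bsub>FPS2 R\<^esub> g) i (Suc 0)) =
      (\<lambda>i. f i 0) \<otimes>\<^bsub>FPS R\<^esub> (\<lambda>i. g i (Suc 0)) \<oplus>\<^bsub>FPS R\<^esub> (\<lambda>i. f i (Suc 0)) \<otimes>\<^bsub>FPS R\<^esub> (\<lambda>i. g i 0)"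
    unfolding eq using * by (simp add: fun_eq_iff FPS_sel(2,3) finsum_addf a_comm)
qed

end

section \<open>Laws with a difference quotient\<close>

abbreviation form_denom :: "('a, 'm) ring_scheme \<Rightarrow> (nat \<Rightarrow> 'a) \<Rightarrow> nat \<Rightarrow> nat \<Rightarrow> 'a" where
  "form_denom R b \<equiv> var_x R \<otimes>\<^bsub>FPS2 R\<^esub> in_y R b \<ominus>\<^bsub>FPS2 R\<^esub> var_y R \<otimes>\<^bsub>FPS2 R\<^esub> in_x R b"

text \<open>The common shape of both laws: the Krichever form with quotient \<open>q\<close>, the
  Buchstaber form with the negative of its quotient in place of \<open>q\<close>.\<close>

abbreviation quotient_form ::
    "('a, 'm) ring_scheme \<Rightarrow> (nat \<Rightarrow> 'a) \<Rightarrow> 'a \<Rightarrow> (nat \<Rightarrow> nat \<Rightarrow> 'a) \<Rightarrow> nat \<Rightarrow> nat \<Rightarrow> 'a" where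
  "quotient_form R b a q \<equiv>
    (var_x R \<otimes>\<^bsub>FPS2 R\<^esub> in_y R b \<oplus>\<^bsub>FPS2 R\<^esub> var_y R \<otimes>\<^bsub>FPS2 R\<^esub> in_x R b
            \<ominus>\<^bsub>FPS2 R\<^esub> const2 R a \<otimes>\<^bsub>FPS2 R\<^esub> var_x R \<otimes>\<^bsub>FPS2 R\<^esub> var_y R)
          \<oplus>\<^bsub>FPS2 R\<^esub> q \<otimes>\<^bsub>FPS2 R\<^esub> var_x R [^]\<^bsub>FPS2 R\<^esub> (2::nat) \<otimes>\<^bsub>FPS2 R\<^esub> var_y R [^]\<^bsub>FPS2 R\<^esub> (2::nat)"

context cring
begin

lemma quotient_form_coeff:
  assumes b: "b \<in> carrier (FPS R)" and a: "a \<in> carrier R" and q: "q \<in> carrier (FPS2 R)"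
  shows "quotient_form R b a q i j =
    ((if i = 1 then b j else \<zero>) \<oplus> (if j = 1 then b i else \<zero>) \<ominus> (if i = 1 \<and> j = 1 then a else \<zero>))
    \<oplus> (if 2 \<le> i \<and> 2 \<le> j then q (i - 2) (j - 2) else \<zero>)"
proof -
  interpret Q: cring "FPS2 R" by (rule cring_FPS2)
  have x: "var_x R \<in> carrier (FPS2 R)" and y: "var_y R \<in> carrier (FPS2 R)"
    and c: "const2 R a \<in> carrier (FPS2 R)" and u: "in_x R b \<in> carrier (FPS2 R)"
    and v: "in_y R b \<in> carrier (FPS2 R)"
    using a b by simp_all
  have "q \<otimes>\<^bsub>FPS2 R\<^esub> var_x R [^]\<^bsub>FPS2 R\<^esub> (2::nat) \<otimes>\<^bsub>FPS2 R\<^esub> var_y R [^]\<^bsub>FPS2 R\<^esub> (2::nat) =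
     q \<otimes>\<^bsub>FPS2 R\<^esub> var_x R \<otimes>\<^bsub>FPS2 R\<^esub> var_x R \<otimes>\<^bsub>FPS2 R\<^esub> var_y R \<otimes>\<^bsub>FPS2 R\<^esub> var_y R"
    using x y q by (simp add: numeral_2_eq_2 Q.m_assoc)
  then have 1: "(q \<otimes>\<^bsub>FPS2 R\<^esub> var_x R [^]\<^bsub>FPS2 R\<^esub> (2::nat) \<otimes>\<^bsub>FPS2 R\<^esub> var_y R [^]\<^bsub>FPS2 R\<^esub> (2::nat)) i j =
     (if 2 \<le> i \<and> 2 \<le> j then q (i - 2) (j - 2) else \<zero>)"
    using x y q by (auto simp: FPS2_mult_x FPS2_mult_y numeral_2_eq_2)
  have 2: "(var_x R \<otimes>\<^bsub>FPS2 R\<^esub> in_y R b) i j = (if i = 1 then b j else \<zero>)"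
    using x v unfolding Q.m_comm[OF x v] FPS2_mult_x[OF v] by (auto simp: in_y_def)
  have 3: "(var_y R \<otimes>\<^bsub>FPS2 R\<^esub> in_x R b) i j = (if j = 1 then b i else \<zero>)"
    using y u unfolding Q.m_comm[OF y u] FPS2_mult_y[OF u] by (auto simp: in_x_def)
  have 4: "(const2 R a \<otimes>\<^bsub>FPS2 R\<^esub> var_x R \<otimes>\<^bsub>FPS2 R\<^esub> var_y R) i j = (if i = 1 \<and> j = 1 then a else \<zero>)"
    unfolding FPS2_mult_y[OF Q.m_closed[OF c x]] FPS2_mult_x[OF c]
    by (auto simp: in_x_def ps_const_def)
  show ?thesis
    using x y c u v
    by (simp add: FPS2_add[where i = i and j = j] FPS2_minus[where i = i and j = j] 1 2 3 4
        del: One_nat_def)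
qed

text \<open>With $p = xv$, $r = yu$, $s = axy$ this rests on $(p+r-s)(p-r) = (p^2-sp)-(r^2-sr)$,
  whose two parts are multiples of $x^2$ and of $y^2$. It is applied in $R[[x,y]]$ with $u = b(x)$
  and $v = b(y)$.\<close>

lemma quotient_form_product:
  assumes cl: "x \<in> carrier R" "y \<in> carrier R" "u \<in> carrier R" "v \<in> carrier R" "a \<in> carrier R" "q \<in> carrier R"
  shows "((x \<otimes> v \<oplus> y \<otimes> u \<ominus> a \<otimes> x \<otimes> y) \<oplus> q \<otimes> x [^] (2::nat) \<otimes> y [^] (2::nat)) \<otimes> (x \<otimes> v \<ominus> y \<otimes> u) =
    (v \<otimes> v \<ominus> a \<otimes> y \<otimes> v) \<otimes> x \<otimes> x \<ominus> (u \<otimes> u \<ominus> a \<otimes> x \<otimes> u) \<otimes> y \<otimes> y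
    \<oplus> q \<otimes> (x \<otimes> v \<ominus> y \<otimes> u) \<otimes> x \<otimes> x \<otimes> y \<otimes> y"
proof -
  have diff: "(p \<oplus> r \<ominus> s) \<otimes> (p \<ominus> r) = (p \<otimes> p \<ominus> s \<otimes> p) \<ominus> (r \<otimes> r \<ominus> s \<otimes> r)"
    if "p \<in> carrier R" "r \<in> carrier R" "s \<in> carrier R" for p r s
    using that by algebra
  have sq: "(x \<otimes> u) \<otimes> (x \<otimes> u) \<ominus> a \<otimes> x \<otimes> y \<otimes> (x \<otimes> u) = (u \<otimes> u \<ominus> a \<otimes> y \<otimes> u) \<otimes> x \<otimes> x"
    if "x \<in> carrier R" "y \<in> carrier R" "u \<in> carrier R" for x y u
    using that cl(5) by algebra
  have "(x \<otimes> v \<oplus> y \<otimes> u \<ominus> a \<otimes> x \<otimes> y) \<otimes> (x \<otimes> v \<ominus> y \<otimes> u) =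
      (x \<otimes> v \<otimes> (x \<otimes> v) \<ominus> a \<otimes> x \<otimes> y \<otimes> (x \<otimes> v)) \<ominus>
      (y \<otimes> u \<otimes> (y \<otimes> u) \<ominus> a \<otimes> y \<otimes> x \<otimes> (y \<otimes> u))"
    using cl by (subst diff) (simp_all add: m_ac)
  moreover have "q \<otimes> x [^] (2::nat) \<otimes> y [^] (2::nat) \<otimes> (x \<otimes> v \<ominus> y \<otimes> u) =
      q \<otimes> (x \<otimes> v \<ominus> y \<otimes> u) \<otimes> x \<otimes> x \<otimes> y \<otimes> y"
    using cl by (simp add: numeral_2_eq_2 m_ac)
  ultimately show ?thesis
    using cl by (subst l_distr) (simp_all add: sq)
qed

text \<open>As the invariant form is \<open>b\<close>, the factor in the definition of the $A_{ij}$
  is \<open>form_denom R b\<close>. The product is then $h(y)x^2 - h(x)y^2$ plus \<open>q\<close>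
  times this factor times $x^2y^2$. The first two terms miss all exponents with $i,j \<ge> 3$, and
  the last one shifts both indices by two.\<close>

lemma A_coeffs_quotient_form:
  assumes b: "b \<in> carrier (FPS R)" and a: "a \<in> carrier R" and q: "q \<in> carrier (FPS2 R)"
    and G: "G = quotient_form R b a q"
    and w: "invariant_form R G = b"
  shows "A_coeffs R G (Suc (Suc (Suc i))) (Suc (Suc (Suc j))) =
    (q \<otimes>\<^bsub>FPS2 R\<^esub> form_denom R b) (Suc i) (Suc j)"
proof -
  interpret P: cring "FPS R" by (rule cring_FPS)
  interpret Q: cring "FPS2 R" by (rule cring_FPS2)
  \<comment> \<open>$h = b^2 - axb$ is the cofactor of $y^2$ in the product formula; the cofactor of
    $x^2$ is the same series in $y$.\<close>
  define h where "h = b \<otimes>\<^bsub>FPS R\<^esub> b \<ominus>\<^bsub>FPS R\<^esub> ps_const R a \<otimes>\<^bsub>FPS R\<^esub> ps_X R \<otimes>\<^bsub>FPS R\<^esub> b"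
  have h: "h \<in> carrier (FPS R)" using a b by (simp add: h_def)
  define qe where "qe = q \<otimes>\<^bsub>FPS2 R\<^esub> form_denom R b"
  have qe: "qe \<in> carrier (FPS2 R)" using b q by (simp add: qe_def)
  have hx: "in_x R b \<otimes>\<^bsub>FPS2 R\<^esub> in_x R b \<ominus>\<^bsub>FPS2 R\<^esub> const2 R a \<otimes>\<^bsub>FPS2 R\<^esub> var_x R \<otimes>\<^bsub>FPS2 R\<^esub> in_x R b = in_x R h"
    using a b ring_hom_mult[OF in_x_hom] ring_hom_minus[OF P.ring_axioms Q.ring_axioms in_x_hom]
    by (simp add: h_def)
  have hy: "in_y R b \<otimes>\<^bsub>FPS2 R\<^esub> in_y R b \<ominus>\<^bsub>FPS2 R\<^esub> const2 R a \<otimes>\<^bsub>FPS2 R\<^esub> var_y R \<otimes>\<^bsub>FPS2 R\<^esub> in_y R b = in_y R h"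
    using a b ring_hom_mult[OF in_y_hom] ring_hom_minus[OF P.ring_axioms Q.ring_axioms in_y_hom]
    by (simp add: h_def const2_eq)
  have "A_coeffs R G = in_y R h \<otimes>\<^bsub>FPS2 R\<^esub> var_x R \<otimes>\<^bsub>FPS2 R\<^esub> var_x R
      \<ominus>\<^bsub>FPS2 R\<^esub> in_x R h \<otimes>\<^bsub>FPS2 R\<^esub> var_y R \<otimes>\<^bsub>FPS2 R\<^esub> var_y R
      \<oplus>\<^bsub>FPS2 R\<^esub> qe \<otimes>\<^bsub>FPS2 R\<^esub> var_x R \<otimes>\<^bsub>FPS2 R\<^esub> var_x R \<otimes>\<^bsub>FPS2 R\<^esub> var_y R \<otimes>\<^bsub>FPS2 R\<^esub> var_y R"
    unfolding A_coeffs_def w unfolding G hx[symmetric] hy[symmetric] qe_def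
    by (rule Q.quotient_form_product) (use a b q in simp_all)
  then show ?thesis
    unfolding qe_def[symmetric] using h qe
    by (simp add: FPS_sel(3) FPS2_minus FPS2_mult_x FPS2_mult_y)
      (auto simp: in_x_def in_y_def FPS_sel(1) a_minus_def)
qed

text \<open>At $y = 0$ the denominator is $x b(0) = x$, and at $x = 0$ it is $-y$. These are the
  coefficients outside the range governed by the $A_{ij}$ with $i,j \<ge> 3$.\<close>

lemma quotient_form_denominator:
  assumes b: "b \<in> carrier (FPS R)" "b 0 = \<one>" and q: "q \<in> carrier (FPS2 R)"
  defines "qe \<equiv> q \<otimes>\<^bsub>FPS2 R\<^esub> form_denom R b"
  shows "qe i 0 = (if i = 0 then \<zero> else q (i - 1) 0)"
    and "qe 0 j = (if j = 0 then \<zero> else \<ominus> q 0 (j - 1))"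
proof -
  interpret Q: cring "FPS2 R" by (rule cring_FPS2)
  have qx: "q \<otimes>\<^bsub>FPS2 R\<^esub> var_x R \<in> carrier (FPS2 R)" and qy: "q \<otimes>\<^bsub>FPS2 R\<^esub> var_y R \<in> carrier (FPS2 R)"
    using q by simp_all
  have "qe = q \<otimes>\<^bsub>FPS2 R\<^esub> var_x R \<otimes>\<^bsub>FPS2 R\<^esub> in_y R b \<ominus>\<^bsub>FPS2 R\<^esub> q \<otimes>\<^bsub>FPS2 R\<^esub> var_y R \<otimes>\<^bsub>FPS2 R\<^esub> in_x R b"
    using q b by (simp add: qe_def a_minus_def Q.r_distr Q.r_minus Q.m_assoc)
  then have eq: "qe i j = ((q \<otimes>\<^bsub>FPS2 R\<^esub> var_x R) i \<otimes>\<^bsub>FPS R\<^esub> b) j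
      \<ominus> (\<Oplus>k\<in>{..i}. (q \<otimes>\<^bsub>FPS2 R\<^esub> var_y R) k j \<otimes> b (i - k))" for i j
    using qx qy b by (simp add: FPS2_minus FPS2_mult_in_y FPS2_mult_in_x)
  have cl: "q i j \<in> carrier R" "b i \<in> carrier R" for i j using q b by (auto simp: FPS_sel)
  show "qe i 0 = (if i = 0 then \<zero> else q (i - 1) 0)"
    unfolding eq FPS_sel(2)[where R=R] using cl by (simp add: FPS2_mult_x[OF q] FPS2_mult_y[OF q] b a_minus_def)
  show "qe 0 j = (if j = 0 then \<zero> else \<ominus> q 0 (j - 1))"
    unfolding eq FPS_sel(2)[where R=R] using cl by (simp add: FPS2_mult_x[OF q] FPS2_mult_y[OF q] b a_minus_def)
qed

end

section \<open>A consequence of associativity\<close>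

context cring
begin

lemma FPS_mult_X_pow:
  assumes "f \<in> carrier (FPS R)"
  shows "(ps_X R [^]\<^bsub>FPS R\<^esub> (m::nat) \<otimes>\<^bsub>FPS R\<^esub> f) i = (if m \<le> i then f (i - m) else \<zero>)"
proof -
  interpret P: cring "FPS R" by (rule cring_FPS)
  show ?thesis
    using assms
  proof (induction m arbitrary: f)
    case 0
    then show ?case by simp
  next
    case (Suc m)
    have eq: "ps_X R [^]\<^bsub>FPS R\<^esub> Suc m \<otimes>\<^bsub>FPS R\<^esub> f = ps_X R [^]\<^bsub>FPS R\<^esub> m \<otimes>\<^bsub>FPS R\<^esub> (ps_X R \<otimes>\<^bsub>FPS R\<^esub> f)"
      using Suc.prems by (simp add: P.m_assoc)
    show ?case
      unfolding eq Suc.IH[OF P.m_closed[OF ps_X_closed Suc.prems]] FPS_mult_X(2)[OF Suc.prems]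
      by auto
  qed
qed

text \<open>Modulo $y^2$ one has $G = x + \<omega>(x)y$, hence $G^m = x^m + m x^{m-1}\<omega>(x)y$.
  Writing the index as \<open>Suc i - m\<close> avoids $m-1$; for $m = 0$ the factor
  \<open>[m]\<close> gives zero.\<close>

lemma FPS2_pow_coeffs:
  assumes G: "G \<in> carrier (FPS2 R)" and G0: "(\<lambda>i. G i 0) = ps_X R"
  shows "(\<lambda>i. (G [^]\<^bsub>FPS2 R\<^esub> (m::nat)) i 0) = ps_X R [^]\<^bsub>FPS R\<^esub> m" (is "?A m")
    and "(G [^]\<^bsub>FPS2 R\<^esub> m) i (Suc 0) = (if m \<le> Suc i then [m] \<cdot> G (Suc i - m) (Suc 0) else \<zero>)" (is "?B m i")
proof -
  interpret P: cring "FPS R" by (rule cring_FPS)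
  interpret Q: cring "FPS2 R" by (rule cring_FPS2)
  have pow: "G [^]\<^bsub>FPS2 R\<^esub> m \<in> carrier (FPS2 R)" for m :: nat using G by simp
  have cl: "f i j \<in> carrier R" if "f \<in> carrier (FPS2 R)" for f i j using that by (simp add: FPS_sel)
  show A: "?A m" for m
  proof (induction m)
    case 0
    show ?case by (simp add: fun_eq_iff FPS_sel)
  next
    case (Suc m)
    then show ?case using FPS2_mult_coeffs01(1)[OF pow G, of m] by (simp add: G0)
  qed
  show "?B m i"
  proof (induction m arbitrary: i)
    case 0
    show ?case by (simp add: FPS_sel)
  next
    case (Suc m)
    have w: "(\<lambda>i. G i (Suc 0)) \<in> carrier (FPS R)" using cl[OF G] by (simp add: FPS_sel)
    have v: "(\<lambda>i. (G [^]\<^bsub>FPS2 R\<^esub> m) i (Suc 0)) \<in> carrier (FPS R)" using cl[OF pow] by (simp add: FPS_sel)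
    have "(G [^]\<^bsub>FPS2 R\<^esub> Suc m) i (Suc 0) = (\<lambda>i. (G [^]\<^bsub>FPS2 R\<^esub> m \<otimes>\<^bsub>FPS2 R\<^esub> G) i (Suc 0)) i"
      by simp
    also have "\<dots> = (if m \<le> i then G (i - m) (Suc 0) else \<zero>) \<oplus>
        (if i = 0 then \<zero> else (G [^]\<^bsub>FPS2 R\<^esub> m) (i - 1) (Suc 0))"
      using fun_cong[OF FPS2_mult_coeffs01(2)[OF pow G], of m i]
      by (simp only: A G0 FPS_sel(3)[where n = i] FPS_mult_X_pow[OF w] FPS_mult_X(1)[OF v])
    also have "\<dots> = (if Suc m \<le> Suc i then [Suc m] \<cdot> G (Suc i - Suc m) (Suc 0) else \<zero>)"
      unfolding Suc.IH using cl[OF G] by (auto simp: a_comm)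
    finally show ?case .
  qed
qed

text \<open>When the two factors share no variable, each coefficient of the product is a single
  product. Both sides of associativity are of this kind, with summands $G(x,y)^m z^n$ and $x^m
  G(y,z)^n$.\<close>

lemma FPS3_mult_coeff:
  assumes f: "f \<in> carrier (FPS2 R)" and p: "p \<in> carrier (FPS R)"
  shows "(in_xy R f \<otimes>\<^bsub>FPS3 R\<^esub> in_yz R (in_y R p)) i j k = f i j \<otimes> p k"
    and "(in_xy R (in_x R p) \<otimes>\<^bsub>FPS3 R\<^esub> in_yz R f) i j k = p i \<otimes> f j k"
proof -
  interpret P: cring "FPS R" by (rule cring_FPS)
  interpret Q: cring "FPS2 R" by (rule cring_FPS2)
  have cl: "f i j \<in> carrier R" "p i \<in> carrier R" "f i \<in> carrier (FPS R)" for i j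
    using f p by (simp_all add: FPS_sel)
  have c1: "in_xy R f \<in> carrier (FPS3 R)" "in_xy R (in_x R p) \<in> carrier (FPS3 R)"
    using ring_hom_closed[OF in_xy_hom] f p by auto
  have c2: "in_xy R f i \<in> carrier (FPS2 R)" using c1(1) by (simp add: FPS_sel)
  have c3: "in_xy R f i j \<in> carrier (FPS R)" using c1(1) by (simp add: FPS_sel)
  have "(in_xy R f \<otimes>\<^bsub>FPS3 R\<^esub> in_yz R (in_y R p)) i j k = (in_xy R f i j \<otimes>\<^bsub>FPS R\<^esub> p) k"
    unfolding in_yz_eq cring.FPS_mult_const(1)[OF cring_FPS2 c1(1) in_closed(2)[OF p]]
      FPS2_mult_in_y[OF c2 p] ..
  also have "\<dots> = f i j \<otimes> p k"
    unfolding in_xy_eq using p cl by (simp add: FPS_mult_const)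
  finally show "(in_xy R f \<otimes>\<^bsub>FPS3 R\<^esub> in_yz R (in_y R p)) i j k = f i j \<otimes> p k" .
  have *: "in_xy R (in_x R p) i = ps_const (FPS R) (ps_const R (p i))"
    by (auto simp: in_xy_def in_x_def ps_const_def fun_eq_iff FPS_sel)
  show "(in_xy R (in_x R p) \<otimes>\<^bsub>FPS3 R\<^esub> in_yz R f) i j k = p i \<otimes> f j k"
    unfolding in_yz_eq cring.FPS_mult_const(1)[OF cring_FPS2 c1(2) f] *
    using f cl by (simp add: cring.FPS_mult_const[OF cring_FPS] FPS_mult_const)
qed

text \<open>Compares the coefficients of $x^i y z$ in the associativity law.\<close>

lemma fgl_quadratic_coeff:
  assumes fgl: "formal_group_law R G"
  defines "w \<equiv> invariant_form R G"
  shows "(w \<otimes>\<^bsub>FPS R\<^esub> ps_deriv R w) i = [(2::nat)] \<cdot> G i 2 \<oplus> w 1 \<otimes> w i"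
proof -
  interpret P: cring "FPS R" by (rule cring_FPS)
  interpret Q: cring "FPS2 R" by (rule cring_FPS2)
  interpret T: cring "FPS3 R" by (rule cring_FPS3)
  have G: "G \<in> carrier (FPS2 R)" and G0: "(\<lambda>i. G i 0) = ps_X R"
    and assoc: "subst3 R G (in_xy R G) (in_yz R (var_y R)) = subst3 R G (in_xy R (var_x R)) (in_yz R G)"
    using fgl by (auto simp: formal_group_law_def)
  have cl: "G i j \<in> carrier R" for i j using G by (simp add: FPS_sel)
  have w: "w i = G i (Suc 0)" for i
    using cl by (simp add: w_def invariant_form_def ps_deriv_def)
  have wcl: "w \<in> carrier (FPS R)" using cl by (simp add: w FPS_sel)
  have G1: "G (Suc 0) 0 = \<one>" "G 0 (Suc 0) = \<one>"
    using fgl by (auto simp: formal_group_law_def ps_X_def fun_eq_iff)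
  have pow: "G [^]\<^bsub>FPS2 R\<^esub> m \<in> carrier (FPS2 R)" for m :: nat using G by simp
  have Xp: "ps_X R [^]\<^bsub>FPS R\<^esub> m \<in> carrier (FPS R)" for m :: nat by simp
  note hp = ring_hom_nat_pow[OF P.ring_axioms Q.ring_axioms] ring_hom_nat_pow[OF Q.ring_axioms T.ring_axioms]
  \<comment> \<open>In $G(x,y)^m z^n$ the exponent of $z$ forces $n = 1$. On the other side, in $x^m
    G(y,z)^n$, the exponent of $x$ forces $m = i$.\<close>
  have L: "((in_xy R G [^]\<^bsub>FPS3 R\<^esub> (m::nat)) \<otimes>\<^bsub>FPS3 R\<^esub> (in_yz R (var_y R) [^]\<^bsub>FPS3 R\<^esub> (n::nat))) i 1 1 =
     (G [^]\<^bsub>FPS2 R\<^esub> m) i 1 \<otimes> (if n = 1 then \<one> else \<zero>)" for m n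
  proof -
    have 1: "in_xy R G [^]\<^bsub>FPS3 R\<^esub> m = in_xy R (G [^]\<^bsub>FPS2 R\<^esub> m)"
      by (simp add: hp(2)[OF in_xy_hom G])
    have 2: "in_yz R (var_y R) [^]\<^bsub>FPS3 R\<^esub> n = in_yz R (in_y R (ps_X R [^]\<^bsub>FPS R\<^esub> n))"
      by (simp add: hp(2)[OF in_yz_hom] hp(1)[OF in_y_hom])
    show ?thesis unfolding 1 2 FPS3_mult_coeff(1)[OF pow Xp] FPS_X_pow by (simp add: eq_commute)
  qed
  have Rt: "((in_xy R (var_x R) [^]\<^bsub>FPS3 R\<^esub> (m::nat)) \<otimes>\<^bsub>FPS3 R\<^esub> (in_yz R G [^]\<^bsub>FPS3 R\<^esub> (n::nat))) i 1 1 =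
     (if i = m then \<one> else \<zero>) \<otimes> (G [^]\<^bsub>FPS2 R\<^esub> n) 1 1" for m n
  proof -
    have 1: "in_yz R G [^]\<^bsub>FPS3 R\<^esub> n = in_yz R (G [^]\<^bsub>FPS2 R\<^esub> n)"
      by (simp add: hp(2)[OF in_yz_hom G])
    have 2: "in_xy R (var_x R) [^]\<^bsub>FPS3 R\<^esub> m = in_xy R (in_x R (ps_X R [^]\<^bsub>FPS R\<^esub> m))"
      by (simp add: hp(2)[OF in_xy_hom] hp(1)[OF in_x_hom])
    show ?thesis unfolding 1 2 FPS3_mult_coeff(2)[OF pow Xp] FPS_X_pow ..
  qed
  have pcl: "(G [^]\<^bsub>FPS2 R\<^esub> (m::nat)) i j \<in> carrier R" for m i j using pow[of m] by (simp add: FPS_sel)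
  have "subst3 R G (in_xy R G) (in_yz R (var_y R)) i 1 1 =
      (\<Oplus>m\<in>{..i+1+1}. \<Oplus>n\<in>{..i+1+1}. if 1 = n then G m n \<otimes> (G [^]\<^bsub>FPS2 R\<^esub> m) i 1 else \<zero>)"
    unfolding subst3_def L using cl pcl
    by (intro finsum_cong) (auto simp: simp_implies_def intro!: finsum_cong finsum_closed)
  also have "\<dots> = (\<Oplus>m\<in>{..Suc (Suc i)}. G m 1 \<otimes> (G [^]\<^bsub>FPS2 R\<^esub> m) i 1)"
    using cl pcl by (simp add: finsum_singleton)
  also have "\<dots> = (\<Oplus>m\<in>{..Suc (Suc i)}. w m \<otimes> (if m \<le> Suc i then [m] \<cdot> w (Suc i - m) else \<zero>))"
    by (simp add: FPS2_pow_coeffs(2)[OF G G0] w cong: if_cong)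
  \<comment> \<open>The summand $m = 0$ dies from its factor \<open>[0]\<close>, and $m = i+2$ lies
    beyond the range of the coefficient formula. The others, reindexed by one, form the convolution
    of $w'$ with $w$.\<close>
  also have "\<dots> = (\<Oplus>m\<in>{..i}. [Suc m] \<cdot> w (Suc m) \<otimes> w (i - m))"
  proof -
    have wc: "w m \<in> carrier R" for m using cl by (simp add: w)
    have "(\<Oplus>m\<in>{..Suc (Suc i)}. w m \<otimes> (if m \<le> Suc i then [m] \<cdot> w (Suc i - m) else \<zero>)) =
        \<zero> \<oplus> (\<Oplus>m\<in>{..Suc i}. w m \<otimes> (if m \<le> Suc i then [m] \<cdot> w (Suc i - m) else \<zero>))"
      using wc by (subst finsum_Suc) (auto simp del: finsum_Suc)
    also have "\<dots> = (\<Oplus>m\<in>{..Suc i}. w m \<otimes> [m] \<cdot> w (Suc i - m))"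
      using wc by (simp del: finsum_Suc cong: finsum_cong)
    also have "\<dots> = (\<Oplus>m\<in>{..i}. w (Suc m) \<otimes> [Suc m] \<cdot> w (i - m)) \<oplus> \<zero>"
      using wc by (subst finsum_Suc2) (auto simp del: finsum_Suc add.nat_pow_Suc)
    also have "\<dots> = (\<Oplus>m\<in>{..i}. [Suc m] \<cdot> w (Suc m) \<otimes> w (i - m))"
      using wc by (simp add: add_pow_ldistr add_pow_rdistr del: add.nat_pow_Suc)
    finally show ?thesis .
  qed
  also have "\<dots> = (ps_deriv R w \<otimes>\<^bsub>FPS R\<^esub> w) i"
    by (simp add: FPS_sel ps_deriv_def)
  finally have lhs: "subst3 R G (in_xy R G) (in_yz R (var_y R)) i 1 1 = (w \<otimes>\<^bsub>FPS R\<^esub> ps_deriv R w) i"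
    using wcl by (simp add: P.m_comm)
  have "subst3 R G (in_xy R (var_x R)) (in_yz R G) i 1 1 =
      (\<Oplus>m\<in>{..i+1+1}. if i = m then (\<Oplus>n\<in>{..i+1+1}. G m n \<otimes> (G [^]\<^bsub>FPS2 R\<^esub> n) 1 1) else \<zero>)"
    unfolding subst3_def Rt using cl pcl
    by (intro finsum_cong)
      (auto simp: simp_implies_def intro!: finsum_closed simp del: finsum_Suc Q.nat_pow_Suc)
  also have "\<dots> = (\<Oplus>n\<in>{..i+1+1}. G i n \<otimes> (G [^]\<^bsub>FPS2 R\<^esub> n) 1 1)"
    by (rule finsum_singleton)
      (use cl pcl in \<open>auto intro!: finsum_closed simp del: finsum_Suc Q.nat_pow_Suc\<close>)
  also have "\<dots> = (\<Oplus>n\<in>{..Suc (Suc i)}. G i n \<otimes> (G [^]\<^bsub>FPS2 R\<^esub> n) 1 1)"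
    by (simp only: Suc_eq_plus1)
  also have "\<dots> = (\<Oplus>n\<in>{..Suc (Suc i)}. G i n \<otimes> (if n \<le> 2 then [n] \<cdot> w (2 - n) else \<zero>))"
    by (simp add: FPS2_pow_coeffs(2)[OF G G0] w numeral_2_eq_2 cong: if_cong)
  \<comment> \<open>Only $n = 1$ and $n = 2$ survive, since $G(y,z)^n$ has no term $yz$ for other
    $n$. The remaining sum is shifted by two, so that its index 0 stands for $n = 2$.\<close>
  also have "\<dots> = (\<Oplus>n\<in>{..i}. if 0 = n then G i 2 \<otimes> [(2::nat)] \<cdot> w 0 else \<zero>) \<oplus> G i 1 \<otimes> w 1"
  proof -
    have "(\<Oplus>n\<in>{..i}. G i (Suc (Suc n)) \<otimes> (if Suc (Suc n) \<le> 2 then [Suc (Suc n)] \<cdot> w (2 - Suc (Suc n)) else \<zero>)) =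
      (\<Oplus>n\<in>{..i}. if 0 = n then G i 2 \<otimes> [(2::nat)] \<cdot> w 0 else \<zero>)"
      using cl by (intro finsum_cong) (auto simp: simp_implies_def numeral_2_eq_2 w)
    then show ?thesis
      using cl by (subst finsum_Suc2, force simp: w, subst finsum_Suc2, force simp: w) (simp add: w)
  qed
  also have "(\<Oplus>n\<in>{..i}. if 0 = n then G i 2 \<otimes> [(2::nat)] \<cdot> w 0 else \<zero>) = G i 2 \<otimes> [(2::nat)] \<cdot> w 0"
    by (rule finsum_singleton) (use cl in \<open>auto simp: w\<close>)
  also have "\<dots> \<oplus> G i 1 \<otimes> w 1 = [(2::nat)] \<cdot> G i 2 \<oplus> w 1 \<otimes> w i"
    using cl by (simp add: w G1 add_pow_rdistr m_comm)
  finally show ?thesis using lhs assoc by simp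
qed

end

section \<open>Krichever and Buchstaber laws through $A_{ij}$\<close>

context cring
begin

lemma minus_mult_mult:
  "\<lbrakk>s \<in> carrier R; q \<in> carrier R; x \<in> carrier R; y \<in> carrier R\<rbrakk> \<Longrightarrow>
    s \<ominus> q \<otimes> x \<otimes> y = s \<oplus> \<ominus> q \<otimes> x \<otimes> y"
  by (simp add: a_minus_def l_minus)

text \<open>Take $c = b$ and $d = -b\<beta>$: the Krichever numerator is already a difference of one
  series at two variables, and the sign turns the added quotient into a subtracted one.\<close>

lemma krichever_imp_buchstaber:
  assumes "krichever_law R G"
  shows "buchstaber_law R G"
proof -
  interpret P: cring "FPS R" by (rule cring_FPS)
  interpret Q: cring "FPS2 R" by (rule cring_FPS2)
  obtain b \<beta> q where cl: "b \<in> carrier (FPS R)" "\<beta> \<in> carrier (FPS R)" "q \<in> carrier (FPS2 R)"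
    and b0: "b 0 = \<one>"
    and q: "q \<otimes>\<^bsub>FPS2 R\<^esub> form_denom R b =
      in_x R b \<otimes>\<^bsub>FPS2 R\<^esub> in_x R \<beta> \<ominus>\<^bsub>FPS2 R\<^esub> in_y R b \<otimes>\<^bsub>FPS2 R\<^esub> in_y R \<beta>"
    and G: "G = quotient_form R b (ps_deriv R b 0) q" and fgl: "formal_group_law R G"
    using assms unfolding krichever_law_def Let_def by blast
  have "\<ominus>\<^bsub>FPS2 R\<^esub> q \<otimes>\<^bsub>FPS2 R\<^esub> form_denom R b = \<ominus>\<^bsub>FPS2 R\<^esub> (in_x R (b \<otimes>\<^bsub>FPS R\<^esub> \<beta>) \<ominus>\<^bsub>FPS2 R\<^esub> in_y R (b \<otimes>\<^bsub>FPS R\<^esub> \<beta>))"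
    using cl by (simp add: Q.l_minus q ring_hom_mult[OF in_x_hom] ring_hom_mult[OF in_y_hom])
  also have "\<dots> = in_x R (\<ominus>\<^bsub>FPS R\<^esub> (b \<otimes>\<^bsub>FPS R\<^esub> \<beta>)) \<ominus>\<^bsub>FPS2 R\<^esub> in_y R (\<ominus>\<^bsub>FPS R\<^esub> (b \<otimes>\<^bsub>FPS R\<^esub> \<beta>))"
    using cl
    by (simp add: a_minus_def Q.minus_add
        ring_hom_a_inv[OF P.ring_axioms Q.ring_axioms in_x_hom]
        ring_hom_a_inv[OF P.ring_axioms Q.ring_axioms in_y_hom])
  finally have q': "\<ominus>\<^bsub>FPS2 R\<^esub> q \<otimes>\<^bsub>FPS2 R\<^esub> form_denom R b = \<dots>" .
  have a: "ps_deriv R b 0 \<in> carrier R"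
    using ps_deriv_closed[OF cl(1)] by (simp add: FPS_sel(1))
  have G': "G = (var_x R \<otimes>\<^bsub>FPS2 R\<^esub> in_y R b \<oplus>\<^bsub>FPS2 R\<^esub> var_y R \<otimes>\<^bsub>FPS2 R\<^esub> in_x R b
      \<ominus>\<^bsub>FPS2 R\<^esub> const2 R (ps_deriv R b 0) \<otimes>\<^bsub>FPS2 R\<^esub> var_x R \<otimes>\<^bsub>FPS2 R\<^esub> var_y R)
      \<ominus>\<^bsub>FPS2 R\<^esub> (\<ominus>\<^bsub>FPS2 R\<^esub> q) \<otimes>\<^bsub>FPS2 R\<^esub> var_x R [^]\<^bsub>FPS2 R\<^esub> (2::nat) \<otimes>\<^bsub>FPS2 R\<^esub> var_y R [^]\<^bsub>FPS2 R\<^esub> (2::nat)"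
    unfolding G by (subst Q.minus_mult_mult) (use cl a in simp_all)
  show ?thesis
    unfolding buchstaber_law_def Let_def
    using cl fgl b0 a q' G'
    by (intro conjI bexI[of _ b] bexI[of _ "\<ominus>\<^bsub>FPS R\<^esub> (b \<otimes>\<^bsub>FPS R\<^esub> \<beta>)"] bexI[of _ "ps_deriv R b 0"]
        bexI[of _ "\<ominus>\<^bsub>FPS2 R\<^esub> q"]) simp_all
qed

text \<open>The term $xy$ receives $b'(0)$ from $xb(y)$ and again from $yb(x)$; the normalization $a
  = b'(0)$ removes one of them. The quotient term starts at $y^2$ and does not reach the coefficient
  of $y$.\<close>

lemma invariant_form_quotient_form:
  assumes b: "b \<in> carrier (FPS R)" and q: "q \<in> carrier (FPS2 R)"
  shows "invariant_form R (quotient_form R b (ps_deriv R b 0) q) = b"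
proof
  fix i
  have inv: "invariant_form R f i = [Suc 0] \<cdot> f i (Suc 0)" for f
    by (simp add: invariant_form_def ps_deriv_def)
  have bc: "b i \<in> carrier R" for i using b by (simp add: FPS_sel)
  have a: "ps_deriv R b 0 = b (Suc 0)" "b (Suc 0) \<in> carrier R" using bc by (simp_all add: ps_deriv_def)
  have "quotient_form R b (b (Suc 0)) q i (Suc 0) = b i"
    unfolding quotient_form_coeff[OF b a(2) q] using bc by (auto simp: a_minus_def a_ac r_neg r_neg1)
  then show "invariant_form R (quotient_form R b (ps_deriv R b 0) q) i = b i"
    unfolding inv a(1) using bc by simp
qed

text \<open>The index shift sends $i,j \<ge> 3$ to mixed coefficients of the numerator, and
  $d(x)-d(y)$ has none.\<close>

lemma buchstaber_A_coeffs:
  assumes "buchstaber_law R G" "3 \<le> i" "3 \<le> j"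
  shows "A_coeffs R G i j = \<zero>"
proof -
  interpret P: cring "FPS R" by (rule cring_FPS)
  interpret Q: cring "FPS2 R" by (rule cring_FPS2)
  obtain c d q where cl: "c \<in> carrier (FPS R)" "d \<in> carrier (FPS R)" "q \<in> carrier (FPS2 R)"
    and c0: "c 0 = \<one>"
    and q: "q \<otimes>\<^bsub>FPS2 R\<^esub> form_denom R c = in_x R d \<ominus>\<^bsub>FPS2 R\<^esub> in_y R d"
    and G: "G = (var_x R \<otimes>\<^bsub>FPS2 R\<^esub> in_y R c \<oplus>\<^bsub>FPS2 R\<^esub> var_y R \<otimes>\<^bsub>FPS2 R\<^esub> in_x R c
      \<ominus>\<^bsub>FPS2 R\<^esub> const2 R (ps_deriv R c 0) \<otimes>\<^bsub>FPS2 R\<^esub> var_x R \<otimes>\<^bsub>FPS2 R\<^esub> var_y R)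
      \<ominus>\<^bsub>FPS2 R\<^esub> q \<otimes>\<^bsub>FPS2 R\<^esub> var_x R [^]\<^bsub>FPS2 R\<^esub> (2::nat) \<otimes>\<^bsub>FPS2 R\<^esub> var_y R [^]\<^bsub>FPS2 R\<^esub> (2::nat)"
    using assms unfolding buchstaber_law_def Let_def by blast
  have a: "ps_deriv R c 0 \<in> carrier R"
    using ps_deriv_closed[OF cl(1)] by (simp add: FPS_sel(1))
  have G': "G = quotient_form R c (ps_deriv R c 0) (\<ominus>\<^bsub>FPS2 R\<^esub> q)"
    unfolding G by (subst Q.minus_mult_mult) (use cl a in simp_all)
  obtain k l where ij: "i = Suc (Suc (Suc k))" "j = Suc (Suc (Suc l))"
    using assms(2,3) by (metis add.commute add_2_eq_Suc' le_Suc_ex numeral_3_eq_3 add_Suc_right numeral_2_eq_2)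
  have "A_coeffs R G i j = (\<ominus>\<^bsub>FPS2 R\<^esub> q \<otimes>\<^bsub>FPS2 R\<^esub> form_denom R c) (Suc k) (Suc l)"
    unfolding ij
    by (rule A_coeffs_quotient_form[OF cl(1) a _ G'])
      (use cl in \<open>simp_all add: G' invariant_form_quotient_form\<close>)
  also have "\<ominus>\<^bsub>FPS2 R\<^esub> q \<otimes>\<^bsub>FPS2 R\<^esub> form_denom R c = in_y R d \<ominus>\<^bsub>FPS2 R\<^esub> in_x R d"
    using cl q by (simp add: Q.l_minus a_minus_def Q.minus_add Q.a_comm)
  also have "\<dots> (Suc k) (Suc l) = \<zero>"
    using cl by (simp add: FPS2_minus) (simp add: in_x_def in_y_def a_minus_def)
  finally show ?thesis .
qed

text \<open>All data are read off from $G$. The hypothesis removes the mixed coefficients of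
  \<open>q\<close> times the denominator; the remaining ones, at $y=0$ and $x=0$, match $g(x)-g(y)$
  because $G$ is symmetric.\<close>

lemma krichever_lawI:
  assumes fgl: "formal_group_law R G" and A: "\<And>i j. 3 \<le> i \<Longrightarrow> 3 \<le> j \<Longrightarrow> A_coeffs R G i j = \<zero>"
  shows "krichever_law R G"
proof -
  interpret P: cring "FPS R" by (rule cring_FPS)
  interpret Q: cring "FPS2 R" by (rule cring_FPS2)
  have Gc: "G \<in> carrier (FPS2 R)" and G0: "G i 0 = ps_X R i" and G0': "G 0 i = ps_X R i"
    and sym: "G i j = G j i" for i j
    using fgl by (auto simp: formal_group_law_def fun_eq_iff)
  have cl: "G i j \<in> carrier R" for i j using Gc by (simp add: FPS_sel)
  define b where "b = invariant_form R G"
  have b: "b i = G i (Suc 0)" for i using cl by (simp add: b_def invariant_form_def ps_deriv_def)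
  have b': "G (Suc 0) i = b i" for i using sym[of "Suc 0" i] by (simp add: b)
  have bc: "b \<in> carrier (FPS R)" and b0: "b 0 = \<one>" and b1: "ps_deriv R b 0 = b (Suc 0)"
    using cl by (simp_all add: b FPS_sel G0' ps_X_def ps_deriv_def)
  have acl: "ps_deriv R b 0 \<in> carrier R" using cl by (simp add: b1 b)
  have bcl: "b i \<in> carrier R" for i using cl b by simp
  define q where "q = (\<lambda>i j. G (i + 2) (j + 2))"
  have qc: "q \<in> carrier (FPS2 R)" using cl by (simp add: q_def FPS_sel)
  \<comment> \<open>The coefficient of $y^2$ in $G$, divided by $x$; this is possible since
    \<open>G 0 2\<close> is zero. The constant term \<open>G 1 2\<close> cancels in $g(x)-g(y)$ and
    is chosen for the relation \<open>two\<close>.\<close>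
  define g where "g = (\<lambda>i. G (Suc i) 2)"
  have gc: "g \<in> carrier (FPS R)" and gcl: "g i \<in> carrier R" for i using cl by (simp_all add: g_def FPS_sel)
  have gq: "q (i - 1) 0 = g i" "q 0 (i - 1) = g i" if "i \<noteq> 0" for i
    using that sym[of 2 "i + 1"] by (auto simp: q_def g_def numeral_2_eq_2)
  have G: "G = quotient_form R b (ps_deriv R b 0) q"
  proof (intro ext)
    fix i j :: nat
    consider "i = 0" | "i = 1" | "j = 0" | "j = 1" | "2 \<le> i" "2 \<le> j" by linarith
    then show "G i j = quotient_form R b (ps_deriv R b 0) q i j"
      unfolding b1 quotient_form_coeff[OF bc bcl qc]
    proof cases
      case 5
      then show "G i j = ((if i = 1 then b j else \<zero>) \<oplus> (if j = 1 then b i else \<zero>) \<ominus>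
        (if i = 1 \<and> j = 1 then b (Suc 0) else \<zero>)) \<oplus> (if 2 \<le> i \<and> 2 \<le> j then q (i - 2) (j - 2) else \<zero>)"
        using cl by (simp add: q_def a_minus_def le_add_diff_inverse2 del: add_2_eq_Suc')
    qed (use cl bcl in \<open>auto simp: b[symmetric] b0 a_minus_def G0 G0' ps_X_def b' l_neg r_neg a_assoc\<close>)
  qed
  have qe: "q \<otimes>\<^bsub>FPS2 R\<^esub> form_denom R b = in_x R g \<ominus>\<^bsub>FPS2 R\<^esub> in_y R g"
  proof (intro ext)
    fix i j :: nat
    have rhs: "(in_x R g \<ominus>\<^bsub>FPS2 R\<^esub> in_y R g) i j = (if j = 0 then g i else \<zero>) \<ominus> (if i = 0 then g j else \<zero>)"
      unfolding FPS2_minus[OF in_closed(1)[OF gc] in_closed(2)[OF gc]] by (simp add: in_x_def in_y_def)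
    have zero_minus: "\<zero> \<ominus> \<zero> = \<zero>" by (simp add: a_minus_def)
    note den = quotient_form_denominator[OF bc b0 qc]
    consider "i = 0" | "j = 0" "i \<noteq> 0" | k l where "i = Suc k" "j = Suc l" by (cases i; cases j) auto
    then show "(q \<otimes>\<^bsub>FPS2 R\<^esub> form_denom R b) i j = (in_x R g \<ominus>\<^bsub>FPS2 R\<^esub> in_y R g) i j"
      unfolding rhs
    proof cases
      case 1
      then show "(q \<otimes>\<^bsub>FPS2 R\<^esub> form_denom R b) i j = (if j = 0 then g i else \<zero>) \<ominus> (if i = 0 then g j else \<zero>)"
        using den(2)[of j] gcl gq by (cases "j = 0") (auto simp: a_minus_def r_neg)
    next
      case 2
      then show "(q \<otimes>\<^bsub>FPS2 R\<^esub> form_denom R b) i j = (if j = 0 then g i else \<zero>) \<ominus> (if i = 0 then g j else \<zero>)"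
        using den(1)[of i] gcl gq by (auto simp: a_minus_def)
    next
      case (3 k l)
      have "(q \<otimes>\<^bsub>FPS2 R\<^esub> form_denom R b) i j = A_coeffs R G (Suc (Suc (Suc k))) (Suc (Suc (Suc l)))"
        unfolding 3 by (rule A_coeffs_quotient_form[OF bc acl qc G b_def[symmetric], symmetric])
      then show "(q \<otimes>\<^bsub>FPS2 R\<^esub> form_denom R b) i j = (if j = 0 then g i else \<zero>) \<ominus> (if i = 0 then g j else \<zero>)"
        using 3 zero_minus by (simp add: A)
    qed
  qed
  obtain \<beta> where \<beta>: "\<beta> \<in> carrier (FPS R)" "b \<otimes>\<^bsub>FPS R\<^esub> \<beta> = g"
    using FPS_divide_exists[OF bc b0 gc] by blast
  \<comment> \<open>The relation for \<open>\<beta>\<close> first appears multiplied by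
    \<open>b\<close>; the inverse \<open>c\<close> cancels this factor.\<close>
  obtain c where c: "c \<in> carrier (FPS R)" "b \<otimes>\<^bsub>FPS R\<^esub> c = \<one>\<^bsub>FPS R\<^esub>"
    using FPS_divide_exists[OF bc b0 P.one_closed] by blast
  define D where "D = ps_deriv R b \<ominus>\<^bsub>FPS R\<^esub> ps_const R (ps_deriv R b 0)"
  have D: "D \<in> carrier (FPS R)" using bc bcl by (simp add: D_def b1)
  have Xg: "(ps_X R \<otimes>\<^bsub>FPS R\<^esub> g) i = G i 2" for i
    unfolding FPS_mult_X(2)[OF gc] by (simp add: g_def G0' ps_X_def)
  have two: "[(2::nat)] \<cdot>\<^bsub>FPS R\<^esub> (ps_X R \<otimes>\<^bsub>FPS R\<^esub> g) = b \<otimes>\<^bsub>FPS R\<^esub> D"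
  proof
    fix i
    have "(b \<otimes>\<^bsub>FPS R\<^esub> D) i = (b \<otimes>\<^bsub>FPS R\<^esub> ps_deriv R b \<ominus>\<^bsub>FPS R\<^esub> b \<otimes>\<^bsub>FPS R\<^esub> ps_const R (b (Suc 0))) i"
      using bc bcl by (simp add: D_def b1 a_minus_def P.r_distr P.r_minus)
    also have "\<dots> = (b \<otimes>\<^bsub>FPS R\<^esub> ps_deriv R b) i \<ominus> b i \<otimes> b (Suc 0)"
      using bc bcl by (subst FPS_minus) (simp_all add: FPS_mult_const)
    \<comment> \<open>Subtracting the constant $b'(0)$ in \<open>D\<close> cancels exactly the
      summand \<open>w 1 \<otimes> w i\<close> that associativity leaves next to
      \<open>G i 2\<close>.\<close>
    also have "\<dots> = [(2::nat)] \<cdot> G i 2"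
      unfolding b_def fgl_quadratic_coeff[OF fgl] unfolding b_def[symmetric]
      using bcl cl by (simp add: a_minus_def a_assoc m_comm r_neg del: add.nat_pow_Suc)
    also have "\<dots> = ([(2::nat)] \<cdot>\<^bsub>FPS R\<^esub> (ps_X R \<otimes>\<^bsub>FPS R\<^esub> g)) i"
      using gc by (simp add: FPS_add_pow Xg)
    finally show "([(2::nat)] \<cdot>\<^bsub>FPS R\<^esub> (ps_X R \<otimes>\<^bsub>FPS R\<^esub> g)) i = (b \<otimes>\<^bsub>FPS R\<^esub> D) i" ..
  qed
  have "b \<otimes>\<^bsub>FPS R\<^esub> [(2::nat)] \<cdot>\<^bsub>FPS R\<^esub> (ps_X R \<otimes>\<^bsub>FPS R\<^esub> \<beta>) = b \<otimes>\<^bsub>FPS R\<^esub> D"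
    unfolding two[symmetric] \<beta>(2)[symmetric] using bc \<beta>(1)
    by (simp add: P.add_pow_rdistr P.m_lcomm)
  then have "c \<otimes>\<^bsub>FPS R\<^esub> b \<otimes>\<^bsub>FPS R\<^esub> [(2::nat)] \<cdot>\<^bsub>FPS R\<^esub> (ps_X R \<otimes>\<^bsub>FPS R\<^esub> \<beta>) = c \<otimes>\<^bsub>FPS R\<^esub> b \<otimes>\<^bsub>FPS R\<^esub> D"
    using bc \<beta>(1) c(1) D by (simp add: P.m_assoc)
  then have "[(2::nat)] \<cdot>\<^bsub>FPS R\<^esub> (ps_X R \<otimes>\<^bsub>FPS R\<^esub> \<beta>) = D"
    using bc \<beta>(1) c D by (simp add: P.m_comm[OF c(1) bc])
  moreover have "q \<otimes>\<^bsub>FPS2 R\<^esub> form_denom R b =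
      in_x R b \<otimes>\<^bsub>FPS2 R\<^esub> in_x R \<beta> \<ominus>\<^bsub>FPS2 R\<^esub> in_y R b \<otimes>\<^bsub>FPS2 R\<^esub> in_y R \<beta>"
    unfolding qe \<beta>(2)[symmetric] ring_hom_mult[OF in_x_hom bc \<beta>(1)] ring_hom_mult[OF in_y_hom bc \<beta>(1)] ..
  ultimately show ?thesis
    unfolding krichever_law_def Let_def D_def using fgl G bc \<beta>(1) qc b0 by blast
qed

end

section \<open>Base change\<close>

text \<open>Each coefficient of the substitution is a finite sum of products, so \<open>h\<close>
  passes through it without any question of convergence.\<close>

lemma subst3_hom:
  assumes "cring R" "cring S" and h: "h \<in> ring_hom R S"
    and F: "F \<in> carrier (FPS2 R)" and f: "f \<in> carrier (FPS3 R)" and g: "g \<in> carrier (FPS3 R)"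
  shows "subst3 S (\<lambda>i j. h (F i j)) (\<lambda>i j k. h (f i j k)) (\<lambda>i j k. h (g i j k)) =
    (\<lambda>i j k. h (subst3 R F f g i j k))"
proof -
  interpret ring_hom_cring R S h
    using assms by (simp add: ring_hom_cring_def ring_hom_cring_axioms_def)
  interpret R3: cring "FPS3 R" by (rule R.cring_FPS3)
  interpret S3: cring "FPS3 S" by (rule S.cring_FPS3)
  have h3: "(\<lambda>f i j k. h (f i j k)) \<in> ring_hom (FPS3 R) (FPS3 S)"
    by (intro ring_hom_FPS h R.cring_FPS2 S.cring_FPS2 R.cring_FPS S.cring_FPS R.is_cring S.is_cring)
  have pw: "(\<lambda>i j k. h ((f [^]\<^bsub>FPS3 R\<^esub> m \<otimes>\<^bsub>FPS3 R\<^esub> g [^]\<^bsub>FPS3 R\<^esub> n) i j k)) =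
    (\<lambda>i j k. h (f i j k)) [^]\<^bsub>FPS3 S\<^esub> m \<otimes>\<^bsub>FPS3 S\<^esub> (\<lambda>i j k. h (g i j k)) [^]\<^bsub>FPS3 S\<^esub> n"
    for m n :: nat
    using ring_hom_mult[OF h3, of "f [^]\<^bsub>FPS3 R\<^esub> m" "g [^]\<^bsub>FPS3 R\<^esub> n"] f g
      ring_hom_nat_pow[OF R3.ring_axioms S3.ring_axioms h3 f]
      ring_hom_nat_pow[OF R3.ring_axioms S3.ring_axioms h3 g] by simp
  have eq: "h ((f [^]\<^bsub>FPS3 R\<^esub> m \<otimes>\<^bsub>FPS3 R\<^esub> g [^]\<^bsub>FPS3 R\<^esub> n) i j k) =
    ((\<lambda>i j k. h (f i j k)) [^]\<^bsub>FPS3 S\<^esub> m \<otimes>\<^bsub>FPS3 S\<^esub> (\<lambda>i j k. h (g i j k)) [^]\<^bsub>FPS3 S\<^esub> n) i j k"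
    for m n :: nat and i j k
    using fun_cong[OF fun_cong[OF fun_cong[OF pw[of m n], of i], of j], of k] by simp
  have cl: "F i j \<in> carrier R" for i j using F by (simp add: FPS_sel)
  have pcl: "(f [^]\<^bsub>FPS3 R\<^esub> m \<otimes>\<^bsub>FPS3 R\<^esub> g [^]\<^bsub>FPS3 R\<^esub> n) i j k \<in> carrier R" for m n :: nat and i j k
  proof -
    have "f [^]\<^bsub>FPS3 R\<^esub> m \<otimes>\<^bsub>FPS3 R\<^esub> g [^]\<^bsub>FPS3 R\<^esub> n \<in> carrier (FPS3 R)" using f g by simp
    then show ?thesis unfolding FPS_sel(1) by blast
  qed
  have sum: "h (\<Oplus>\<^bsub>R\<^esub>n\<in>A. t n) = (\<Oplus>\<^bsub>S\<^esub>n\<in>A. h (t n))" if "\<And>n. t n \<in> carrier R" for t and A :: "nat set"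
    using hom_finsum[of t A] that by (simp add: o_def Pi_iff)
  show ?thesis
  proof (intro ext)
    fix i j k :: nat
    define A where "A = {..i + j + k}"
    define X where "X m n = (f [^]\<^bsub>FPS3 R\<^esub> m \<otimes>\<^bsub>FPS3 R\<^esub> g [^]\<^bsub>FPS3 R\<^esub> n) i j k" for m n :: nat
    have Xcl: "X m n \<in> carrier R" for m n unfolding X_def by (rule pcl)
    have "h (subst3 R F f g i j k) = (\<Oplus>\<^bsub>S\<^esub>m\<in>A. h (\<Oplus>\<^bsub>R\<^esub>n\<in>A. F m n \<otimes>\<^bsub>R\<^esub> X m n))"
      unfolding subst3_def A_def[symmetric] X_def[symmetric]
      by (rule sum) (use cl Xcl in \<open>auto intro!: R.finsum_closed\<close>)
    also have "\<dots> = (\<Oplus>\<^bsub>S\<^esub>m\<in>A. \<Oplus>\<^bsub>S\<^esub>n\<in>A. h (F m n) \<otimes>\<^bsub>S\<^esub> h (X m n))"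
      using cl Xcl by (simp add: sum)
    finally show "subst3 S (\<lambda>i j. h (F i j)) (\<lambda>i j k. h (f i j k)) (\<lambda>i j k. h (g i j k)) i j k =
      h (subst3 R F f g i j k)"
      unfolding subst3_def A_def[symmetric] eq[symmetric] X_def[symmetric] by (rule sym)
  qed
qed

lemma formal_group_law_hom:
  assumes "cring S" and h: "h \<in> ring_hom R S" and fgl: "formal_group_law R G"
  shows "formal_group_law S (\<lambda>i j. h (G i j))"
proof -
  have "cring R" using fgl by (simp add: formal_group_law_def)
  interpret ring_hom_cring R S h
    using assms(1) h \<open>cring R\<close> by (simp add: ring_hom_cring_def ring_hom_cring_axioms_def)
  have G: "G \<in> carrier (FPS2 R)" and cl: "G i j \<in> carrier R" for i j
    using fgl by (auto simp: formal_group_law_def FPS_sel)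
  have G0: "G i 0 = ps_X R i" "G 0 i = ps_X R i" and sym: "G i j = G j i" for i j
    using fgl by (auto simp: formal_group_law_def fun_eq_iff)
  have assoc: "subst3 R G (in_xy R G) (in_yz R (var_y R)) = subst3 R G (in_xy R (var_x R)) (in_yz R G)"
    using fgl by (auto simp: formal_group_law_def)
  have 1: "(\<lambda>i j k. h (in_xy R f i j k)) = in_xy S (\<lambda>i j. h (f i j))"
    "(\<lambda>i j k. h (in_yz R f i j k)) = in_yz S (\<lambda>i j. h (f i j))" for f
    by (auto simp: in_xy_def in_yz_def fun_eq_iff)
  have 2: "(\<lambda>i j. h (var_x R i j)) = var_x S" "(\<lambda>i j. h (var_y R i j)) = var_y S"
    by (auto simp: in_x_def in_y_def ps_X_def fun_eq_iff)
  have 3: "in_xy R f \<in> carrier (FPS3 R)" "in_yz R f \<in> carrier (FPS3 R)" if "f \<in> carrier (FPS2 R)" for f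
    using ring_hom_closed[OF R.in_xy_hom that] ring_hom_closed[OF R.in_yz_hom that] by auto
  note sub = subst3_hom[OF R.is_cring S.is_cring h G, symmetric]
  have xy: "var_x R \<in> carrier (FPS2 R)" "var_y R \<in> carrier (FPS2 R)" by simp_all
  have "subst3 S (\<lambda>i j. h (G i j)) (in_xy S (\<lambda>i j. h (G i j))) (in_yz S (var_y S)) =
    subst3 S (\<lambda>i j. h (G i j)) (in_xy S (var_x S)) (in_yz S (\<lambda>i j. h (G i j)))"
    using sub[OF 3(1)[OF G] 3(2)[OF xy(2)]] sub[OF 3(1)[OF xy(1)] 3(2)[OF G]]
    unfolding assoc 1 2 by simp
  then show ?thesis
    unfolding formal_group_law_def using cl assms(1) sym
    by (auto simp: FPS_sel G0 ps_X_def fun_eq_iff)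
qed

text \<open>Links the two readings of the Nadiradze condition: a classifying map kills the $A_{ij}$
  of the universal law exactly when the $A_{ij}$ of the classified law vanish.\<close>

lemma A_coeffs_hom:
  assumes "cring S" and h: "h \<in> ring_hom R S" and fgl: "formal_group_law R G"
  shows "A_coeffs S (\<lambda>i j. h (G i j)) i j = h (A_coeffs R G i j)"
    and "A_coeffs R G i j \<in> carrier R"
proof -
  have "cring R" using fgl by (simp add: formal_group_law_def)
  interpret ring_hom_cring R S h
    using assms(1) h \<open>cring R\<close> by (simp add: ring_hom_cring_def ring_hom_cring_axioms_def)
  interpret R2: cring "FPS2 R" by (rule R.cring_FPS2)
  interpret S2: cring "FPS2 S" by (rule S.cring_FPS2)
  have G: "G \<in> carrier (FPS2 R)" and cl: "G i j \<in> carrier R" for i j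
    using fgl by (auto simp: formal_group_law_def FPS_sel)
  have w: "invariant_form R G \<in> carrier (FPS R)"
    using cl by (simp add: invariant_form_def ps_deriv_def FPS_sel)
  have hw: "invariant_form S (\<lambda>i j. h (G i j)) = (\<lambda>i. h (invariant_form R G i))"
    using cl by (simp add: invariant_form_def ps_deriv_def)
  have h2: "(\<lambda>f i j. h (f i j)) \<in> ring_hom (FPS2 R) (FPS2 S)"
    by (intro ring_hom_FPS h R.cring_FPS S.cring_FPS R.is_cring S.is_cring)
  have i: "in_x S (\<lambda>i. h (f i)) = (\<lambda>i j. h (in_x R f i j))"
    "in_y S (\<lambda>i. h (f i)) = (\<lambda>i j. h (in_y R f i j))" for f
    by (auto simp: in_x_def in_y_def fun_eq_iff)
  have X: "ps_X S = (\<lambda>i. h (ps_X R i))" by (auto simp: ps_X_def)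
  have "A_coeffs S (\<lambda>i j. h (G i j)) = (\<lambda>i j. h (A_coeffs R G i j))"
    unfolding A_coeffs_def hw X i
    using G w ring_hom_mult[OF h2, symmetric] ring_hom_minus[OF R2.ring_axioms S2.ring_axioms h2, symmetric]
    by simp
  then show "A_coeffs S (\<lambda>i j. h (G i j)) i j = h (A_coeffs R G i j)" by simp
  have "A_coeffs R G \<in> carrier (FPS2 R)" unfolding A_coeffs_def using G w by simp
  then show "A_coeffs R G i j \<in> carrier R" unfolding FPS_sel(1) by blast
qed

section \<open>The Nadiradze quotient and its universal property\<close>

lemma nadiradze_ideal:
  assumes "formal_group_law L F"
  shows "ideal (nadiradze_ideal L F) L"
    and "i \<ge> 3 \<Longrightarrow> j \<ge> 3 \<Longrightarrow> A_coeffs L F i j \<in> nadiradze_ideal L F"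
proof -
  interpret cring L using assms by (simp add: formal_group_law_def)
  \<comment> \<open>\<open>A_coeffs_hom\<close> is stated along a homomorphism; the identity gives
    its closure part over \<open>L\<close> itself.\<close>
  have "id \<in> ring_hom L L" by (simp add: ring_hom_def)
  then have sub: "{A_coeffs L F i j | i j. i \<ge> 3 \<and> j \<ge> 3} \<subseteq> carrier L"
    using A_coeffs_hom(2)[OF is_cring _ assms] by blast
  show "ideal (nadiradze_ideal L F) L"
    unfolding nadiradze_ideal_def by (rule genideal_ideal[OF sub])
  show "i \<ge> 3 \<Longrightarrow> j \<ge> 3 \<Longrightarrow> A_coeffs L F i j \<in> nadiradze_ideal L F"
    unfolding nadiradze_ideal_def using genideal_self[OF sub] by blast
qed

lemma universal_nadiradze_law_A_coeffs:
  assumes fgl: "formal_group_law L F"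
  defines "N \<equiv> nadiradze_ring L F" and "FN \<equiv> universal_nadiradze_law L F"
  shows "cring N" "formal_group_law N FN"
    and "i \<ge> 3 \<Longrightarrow> j \<ge> 3 \<Longrightarrow> A_coeffs N FN i j = \<zero>\<^bsub>N\<^esub>"
proof -
  have L: "cring L" using fgl by (simp add: formal_group_law_def)
  interpret ideal "nadiradze_ideal L F" L by (rule nadiradze_ideal(1)[OF fgl])
  show N: "cring N" unfolding N_def nadiradze_ring_def by (rule quotient_is_cring[OF L])
  have hom: "(+>\<^bsub>L\<^esub>) (nadiradze_ideal L F) \<in> ring_hom L N"
    unfolding N_def nadiradze_ring_def by (rule rcos_ring_hom)
  show "formal_group_law N FN"
    unfolding FN_def universal_nadiradze_law_def by (rule formal_group_law_hom[OF N hom fgl])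
  assume "i \<ge> 3" "j \<ge> 3"
  then have "A_coeffs L F i j \<in> nadiradze_ideal L F" by (rule nadiradze_ideal(2)[OF fgl])
  then show "A_coeffs N FN i j = \<zero>\<^bsub>N\<^esub>"
    unfolding FN_def universal_nadiradze_law_def A_coeffs_hom(1)[OF N hom fgl]
    by (simp add: a_rcos_zero[OF ideal_axioms] N_def nadiradze_ring_def FactRing_def)
qed

text \<open>Closes the cycle: Krichever form, Buchstaber form, vanishing of the $A_{ij}$, Krichever
  form.\<close>

lemma krichever_iff_A_coeffs:
  assumes "formal_group_law R G"
  shows "krichever_law R G \<longleftrightarrow> (\<forall>i\<ge>3. \<forall>j\<ge>3. A_coeffs R G i j = \<zero>\<^bsub>R\<^esub>)"
    and "buchstaber_law R G \<longleftrightarrow> (\<forall>i\<ge>3. \<forall>j\<ge>3. A_coeffs R G i j = \<zero>\<^bsub>R\<^esub>)"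
proof -
  interpret cring R using assms by (simp add: formal_group_law_def)
  show "krichever_law R G \<longleftrightarrow> (\<forall>i\<ge>3. \<forall>j\<ge>3. A_coeffs R G i j = \<zero>\<^bsub>R\<^esub>)"
    and "buchstaber_law R G \<longleftrightarrow> (\<forall>i\<ge>3. \<forall>j\<ge>3. A_coeffs R G i j = \<zero>\<^bsub>R\<^esub>)"
    using krichever_lawI[OF assms] krichever_imp_buchstaber buchstaber_A_coeffs by blast+
qed

text \<open>The abstract \<open>P\<close> lets one argument serve both kinds of law. A classifying
  map on \<open>L\<close> kills the generators of the ideal and so factors through the quotient;
  uniqueness is inherited from \<open>L\<close> by composing with the projection.\<close>

lemma classifies_nadiradze:
  fixes L :: "('l, 'm) ring_scheme" and P :: "'r ring \<Rightarrow> (nat \<Rightarrow> nat \<Rightarrow> 'r) \<Rightarrow> bool"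
  assumes fgl: "formal_group_law L F"
    and cls: "classifies (formal_group_law :: 'r ring \<Rightarrow> (nat \<Rightarrow> nat \<Rightarrow> 'r) \<Rightarrow> bool) L F"
    and P: "\<And>R G. P R G \<Longrightarrow> formal_group_law R G"
      "\<And>R G i j. P R G \<Longrightarrow> i \<ge> 3 \<Longrightarrow> j \<ge> 3 \<Longrightarrow> A_coeffs R G i j = \<zero>\<^bsub>R\<^esub>"
  shows "classifies P (nadiradze_ring L F) (universal_nadiradze_law L F)"
  unfolding classifies_def
proof (intro allI impI)
  fix R :: "'r ring" and G
  assume PR: "P R G"
  define I where "I = nadiradze_ideal L F"
  define N where "N = nadiradze_ring L F"
  have N: "N = L Quot I" by (simp add: N_def I_def nadiradze_ring_def)
  have uni: "\<exists>!r. r \<in> extensional (carrier L) \<and> classifying_map L F R G r"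
    using cls P(1)[OF PR] by (simp add: classifies_def)
  then obtain r where r: "r \<in> extensional (carrier L)" "classifying_map L F R G r" by blast
  have "cring L" "cring R" using fgl P(1)[OF PR] by (simp_all add: formal_group_law_def)
  have hom: "r \<in> ring_hom L R" and rF: "r (F i j) = G i j" for i j
    using r(2) by (auto simp: classifying_map_def)
  interpret ring_hom_cring L R r
    using \<open>cring L\<close> \<open>cring R\<close> hom by (simp add: ring_hom_cring_def ring_hom_cring_axioms_def)
  interpret I: ideal I L unfolding I_def by (rule nadiradze_ideal(1)[OF fgl])
  have Fcl: "F i j \<in> carrier L" for i j using fgl by (simp add: formal_group_law_def FPS_sel)
  have "I \<subseteq> a_kernel L R r"
    unfolding I_def nadiradze_ideal_def
  proof (rule R.genideal_minimal[OF ring_hom_ring.kernel_is_ideal[OF ring_hom_ringI2[OF R.ring_axioms S.ring_axioms hom]]], safe)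
    fix i j :: nat assume ij: "i \<ge> 3" "j \<ge> 3"
    have "r (A_coeffs L F i j) = A_coeffs R G i j"
      using A_coeffs_hom(1)[OF \<open>cring R\<close> hom fgl, of i j] by (simp add: rF)
    then show "A_coeffs L F i j \<in> a_kernel L R r"
      unfolding a_kernel_def' using P(2)[OF PR ij] A_coeffs_hom(2)[OF \<open>cring R\<close> hom fgl, of i j]
      by (intro CollectI conjI) (simp_all only:)
  qed
  then have ker: "r a = \<zero>\<^bsub>R\<^esub>" "a \<in> carrier L" if "a \<in> I" for a
    using subsetD[OF _ that] unfolding a_kernel_def' by blast+
  have pi: "(+>\<^bsub>L\<^esub>) I \<in> ring_hom L N" unfolding N by (rule I.rcos_ring_hom)
  have Nc: "carrier N = (\<lambda>a. I +>\<^bsub>L\<^esub> a) ` carrier L"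
    by (auto simp: N FactRing_def A_RCOSETS_def')
  have img: "r ` (I +>\<^bsub>L\<^esub> a) = {r a}" if a: "a \<in> carrier L" for a
  proof -
    have "r x = r a" if "x \<in> I +>\<^bsub>L\<^esub> a" for x
      using that a ker by (auto simp: a_r_coset_def')
    moreover have "a \<in> I +>\<^bsub>L\<^esub> a" using a by (rule I.a_rcos_self)
    ultimately show ?thesis by blast
  qed
  \<comment> \<open>\<open>r\<close> is constant on each coset, so its image there is a singleton;
    \<open>restrict\<close> provides the extensionality that \<open>classifies\<close>
    demands.\<close>
  define s where "s = restrict (\<lambda>C. the_elem (r ` C)) (carrier N)"
  have s: "s (I +>\<^bsub>L\<^esub> a) = r a" if "a \<in> carrier L" for a
    using that by (simp add: s_def Nc img)
  have "s \<in> ring_hom N R"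
  proof (rule ring_hom_memI)
    show "s x \<in> carrier R" if "x \<in> carrier N" for x using that by (auto simp: Nc s)
    show "s (x \<otimes>\<^bsub>N\<^esub> y) = s x \<otimes>\<^bsub>R\<^esub> s y" "s (x \<oplus>\<^bsub>N\<^esub> y) = s x \<oplus>\<^bsub>R\<^esub> s y"
      if "x \<in> carrier N" "y \<in> carrier N" for x y
      using that by (auto simp: Nc s ring_hom_mult[OF pi, symmetric] ring_hom_add[OF pi, symmetric])
    show "s \<one>\<^bsub>N\<^esub> = \<one>\<^bsub>R\<^esub>" by (simp add: ring_hom_one[OF pi, symmetric] s)
  qed
  then have 1: "s \<in> extensional (carrier N) \<and> classifying_map N (universal_nadiradze_law L F) R G s"
    using Fcl by (simp add: classifying_map_def universal_nadiradze_law_def I_def[symmetric] s rF)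
      (simp add: s_def)
  have 2: "t = s" if t: "t \<in> extensional (carrier N)" "classifying_map N (universal_nadiradze_law L F) R G t" for t
  proof -
    have th: "t \<in> ring_hom N R" and tF: "t (I +>\<^bsub>L\<^esub> F i j) = G i j" for i j
      using t(2) by (auto simp: classifying_map_def universal_nadiradze_law_def I_def)
    \<comment> \<open>The composite of \<open>t\<close> with the projection, made extensional so
      that the uniqueness of \<open>r\<close> applies to it.\<close>
    have "restrict (\<lambda>a. t (I +>\<^bsub>L\<^esub> a)) (carrier L) \<in> ring_hom L R"
      using ring_hom_closed[OF th] ring_hom_closed[OF pi] ring_hom_mult[OF th] ring_hom_mult[OF pi]
        ring_hom_add[OF th] ring_hom_add[OF pi] ring_hom_one[OF th] ring_hom_one[OF pi]
      by (intro ring_hom_memI) simp_all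
    then have "classifying_map L F R G (restrict (\<lambda>a. t (I +>\<^bsub>L\<^esub> a)) (carrier L))"
      using Fcl by (simp add: classifying_map_def tF)
    then have "restrict (\<lambda>a. t (I +>\<^bsub>L\<^esub> a)) (carrier L) = r"
      using uni r by (metis restrict_extensional)
    then have "t (I +>\<^bsub>L\<^esub> a) = s (I +>\<^bsub>L\<^esub> a)" if "a \<in> carrier L" for a
      using that s by (metis restrict_apply')
    then show ?thesis
      using t(1) 1 by (intro extensionalityI[of _ "carrier N"]) (auto simp: Nc)
  qed
  show "\<exists>!s. s \<in> extensional (carrier (nadiradze_ring L F)) \<and>
      classifying_map (nadiradze_ring L F) (universal_nadiradze_law L F) R G s"
    using 1 2 unfolding N_def by blast
qed

theorem theorem2p3:
  fixes L :: "'l ring" and F :: "nat \<Rightarrow> nat \<Rightarrow> 'l"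
  assumes "universal_formal_group_law TYPE('r) L F"
  shows "universal_buchstaber_law TYPE('r) (nadiradze_ring L F) (universal_nadiradze_law L F) \<and>
         universal_krichever_law TYPE('r) (nadiradze_ring L F) (universal_nadiradze_law L F) \<and>
         (\<forall>(R :: 'r ring) G.
            (buchstaber_law R G \<longleftrightarrow> krichever_law R G) \<and>
            (krichever_law R G \<longleftrightarrow> nadiradze_law L F R G))"
proof -
  have fgl: "formal_group_law L F"
    and cls: "classifies (formal_group_law :: 'r ring \<Rightarrow> (nat \<Rightarrow> nat \<Rightarrow> 'r) \<Rightarrow> bool) L F"
    using assms by (auto simp: universal_formal_group_law_def)
  note N = universal_nadiradze_law_A_coeffs[OF fgl]
  have law: "formal_group_law R G" if "krichever_law R G \<or> buchstaber_law R G \<or> nadiradze_law L F R G"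
    for R :: "'r ring" and G
    using that by (auto simp: krichever_law_def buchstaber_law_def nadiradze_law_def)
  have A0: "A_coeffs R G i j = \<zero>\<^bsub>R\<^esub>"
    if "krichever_law R G \<or> buchstaber_law R G" "i \<ge> 3" "j \<ge> 3" for R :: "'r ring" and G i j
    using krichever_iff_A_coeffs[OF law[of R G]] that by auto
  \<comment> \<open>Universality of \<open>F\<close> supplies a classifying map, and base change
    makes the condition on it independent of which one is taken.\<close>
  have nad: "nadiradze_law L F R G \<longleftrightarrow> (\<forall>i\<ge>3. \<forall>j\<ge>3. A_coeffs R G i j = \<zero>\<^bsub>R\<^esub>)"
    if R: "formal_group_law R G" for R :: "'r ring" and G
  proof -
    have "cring R" using R by (simp add: formal_group_law_def)
    have A: "r (A_coeffs L F i j) = A_coeffs R G i j" if "classifying_map L F R G r" for r i j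
      using A_coeffs_hom(1)[OF \<open>cring R\<close> _ fgl, of r i j] that by (simp add: classifying_map_def)
    obtain r where "classifying_map L F R G r" using cls R unfolding classifies_def by blast
    then show ?thesis using R A unfolding nadiradze_law_def by metis
  qed
  \<comment> \<open>The quotient ring lives on sets of elements of \<open>L\<close>, outside the
    type over which laws are classified; the criterion through the $A_{ij}$ applies over any
    type.\<close>
  have "buchstaber_law (nadiradze_ring L F) (universal_nadiradze_law L F)"
    "krichever_law (nadiradze_ring L F) (universal_nadiradze_law L F)"
    unfolding krichever_iff_A_coeffs[OF N(2)] using N(3) by simp_all
  moreover have "classifies (buchstaber_law :: 'r ring \<Rightarrow> (nat \<Rightarrow> nat \<Rightarrow> 'r) \<Rightarrow> bool)
      (nadiradze_ring L F) (universal_nadiradze_law L F)"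
    by (rule classifies_nadiradze[OF fgl cls]) (use law A0 in auto)
  moreover have "classifies (krichever_law :: 'r ring \<Rightarrow> (nat \<Rightarrow> nat \<Rightarrow> 'r) \<Rightarrow> bool)
      (nadiradze_ring L F) (universal_nadiradze_law L F)"
    by (rule classifies_nadiradze[OF fgl cls]) (use law A0 in auto)
  moreover have "(buchstaber_law R G \<longleftrightarrow> krichever_law R G) \<and> (krichever_law R G \<longleftrightarrow> nadiradze_law L F R G)"
    for R :: "'r ring" and G
    using law nad[of R G] krichever_iff_A_coeffs[of R G] by blast
  ultimately show ?thesis
    unfolding universal_buchstaber_law_def universal_krichever_law_def by simp
qed

end
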